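(* Let $G$ be a finite group, $V$ an orthogonal $G$-representation, $X$ an algebra in $G$-spaces over the operad $\mathcal{D}(V)$, $H\subset G$ a subgroup, and $T$ a finite $H$-set. Then the space $\mathrm{Emb}^H(T,V)$ encodes $H$-equivariant multiplications $$\mathrm{Map}(T,X)\to X.$$ That is, choosing an ordering of $T$ (with $n=|T|$) and writing $\Gamma_T\subset G\times\Sigma_n$ for the associated graph subgroup, each point of $\mathcal{D}(V)_n^{\Gamma_T}\simeq \mathrm{Emb}^H(T,V)$ determines, through the operadic action $\mathcal{D}(V)_n\times_{\Sigma_n}X^{\times n}\to X$, such an $H$-equivariant map.
   Context: $V$ need not be finite dimensional, need not be a universe, and need not contain a trivial summand. For a finite dimensional subrepresentation $W\subset V$ with unit disk $D(W)$, a little disk in $W$ is a (not necessarily equivariant) affine map $D(W)\to D(W)$, $x\mapsto rx+c$ with $r>0$, $c\in W$. $\mathcal{D}_W(V)_n$ is the space of $n$-tuples of nonoverlapping little disks in $W$, a $G\times\Sigma_n$-space where $G$ acts by conjugation and $\Sigma_n$ by permuting the tuple. If $W\subset W'$, the same affine formulas give $\mathcal{D}_W(V)_n\to\mathcal{D}_{W'}(V)_n$, and $\mathcal{D}(V)_n=\mathrm{colim}_W\,\mathcal{D}_W(V)_n$; the operad structure is given by composition, and $\mathcal{D}(V)_0=\ast$. For a subgroup $H\subset G$ and a finite $H$-set $T$, $\mathrm{Emb}^H(T,V)$ is the space of $H$-equivariant embeddings (injective maps) $T\to V$. $\mathrm{Map}(T,X)$ is the space of all maps with the conjugation $H$-action.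 If $|T|=n$, an ordering of $T$ gives a homomorphism $\phi\colon H\to\Sigma_n$, and $\Gamma_T=\{(h,\phi(h)) : h\in H\}\subset G\times\Sigma_n$ is its graph; taking a disk to its center identifies $\mathcal{D}(V)_n^{\Gamma_T}$ up to weak equivalence with $\mathrm{Emb}^H(T,V)$. If $\mathrm{Emb}^H(T,V)$ is empty there are no such multiplications. *)

theory Defs
  imports
    "HOL-Analysis.Analysis"
    "HOL-Algebra.Group_Action"
    "HOL-Algebra.Sym_Groups"
begin

unbundle no m_inv_syntax

section \<open>Colimits along inclusions and weak equivalences\<close>

text \<open>
  The colimit of a directed system of spaces whose transition maps are inclusions of sets:
  the union, with the final topology.
\<close>

definition union_topology :: "'i set \<Rightarrow> ('i \<Rightarrow> 'a topology) \<Rightarrow> 'a topology" where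
  "union_topology I X = topology (\<lambda>U. U \<subseteq> (\<Union>i\<in>I. topspace (X i)) \<and>
     (\<forall>i\<in>I. openin (X i) (U \<inter> topspace (X i))))"

lemma openin_union_topology:
  "openin (union_topology I X) U \<longleftrightarrow> U \<subseteq> (\<Union>i\<in>I. topspace (X i)) \<and>
     (\<forall>i\<in>I. openin (X i) (U \<inter> topspace (X i)))"
proof -
  have "istopology (\<lambda>U. U \<subseteq> (\<Union>i\<in>I. topspace (X i)) \<and>
     (\<forall>i\<in>I. openin (X i) (U \<inter> topspace (X i))))"
    unfolding istopology_def
  proof (intro conjI allI impI, goal_cases)
    case (1 S T)
    then show ?case by blast
  next
    case (2 S T)
    show ?case
    proof
      fix i assume "i \<in> I"
      then have "openin (X i) ((S \<inter> topspace (X i)) \<inter> (T \<inter> topspace (X i)))"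
        using 2 by blast
      then show "openin (X i) (S \<inter> T \<inter> topspace (X i))"
        by (simp add: Int_ac)
    qed
  next
    case (3 K)
    then show ?case by blast
  next
    case (4 K)
    show ?case
    proof
      fix i assume "i \<in> I"
      then have "openin (X i) (\<Union>S\<in>K. S \<inter> topspace (X i))"
        using 4 by blast
      then show "openin (X i) (\<Union>K \<inter> topspace (X i))"
        by (simp add: Int_commute Int_Union)
    qed
  qed
  then show ?thesis
    by (simp add: union_topology_def)
qed

lemma topspace_union_topology:
  "topspace (union_topology I X) = (\<Union>i\<in>I. topspace (X i))"
proof (rule antisym)
  show "topspace (union_topology I X) \<subseteq> (\<Union>i\<in>I. topspace (X i))"
    using openin_topspace[of "union_topology I X"] unfolding openin_union_topology by blast
  have "(\<Union>j\<in>I. topspace (X j)) \<inter> topspace (X i) = topspace (X i)" if "i \<in> I" for i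
    using that by blast
  then have "openin (union_topology I X) (\<Union>i\<in>I. topspace (X i))"
    by (auto simp: openin_union_topology)
  then show "(\<Union>i\<in>I. topspace (X i)) \<subseteq> topspace (union_topology I X)"
    by (rule openin_subset)
qed

definition sphere_base :: "nat \<Rightarrow> real" where
  "sphere_base = (\<lambda>i. if i = 0 then 1 else 0)"

definition pointed_sphere_map :: "nat \<Rightarrow> 'a topology \<Rightarrow> 'a \<Rightarrow> ((nat \<Rightarrow> real) \<Rightarrow> 'a) \<Rightarrow> bool" where
  "pointed_sphere_map k X x a \<longleftrightarrow> continuous_map (nsphere k) X a \<and> a sphere_base = x"

definition pointed_sphere_homotopic ::
  "nat \<Rightarrow> 'a topology \<Rightarrow> 'a \<Rightarrow> ((nat \<Rightarrow> real) \<Rightarrow> 'a) \<Rightarrow> ((nat \<Rightarrow> real) \<Rightarrow> 'a) \<Rightarrow> bool" where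
  "pointed_sphere_homotopic k X x = homotopic_with (\<lambda>a. a sphere_base = x) (nsphere k) X"

text \<open>
  A continuous map inducing a bijection on path components and, for every \<open>k \<ge> 1\<close> and every
  base point, a bijection on the \<open>k\<close>-th homotopy group, i.e. on pointed homotopy classes of maps
  out of the \<open>k\<close>-sphere.  (The induced map is a homomorphism in any case.)
\<close>

definition weak_equivalence :: "'a topology \<Rightarrow> 'b topology \<Rightarrow> ('a \<Rightarrow> 'b) \<Rightarrow> bool" where
  "weak_equivalence X Y f \<longleftrightarrow>
     continuous_map X Y f \<and>
     (\<forall>x\<in>topspace X. \<forall>x'\<in>topspace X.
        path_component_of Y (f x) (f x') \<longrightarrow> path_component_of X x x') \<and>
     (\<forall>y\<in>topspace Y. \<exists>x\<in>topspace X. path_component_of Y (f x) y) \<and>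
     (\<forall>k\<ge>1. \<forall>x\<in>topspace X.
        (\<forall>a a'. pointed_sphere_map k X x a \<and> pointed_sphere_map k X x a' \<and>
           pointed_sphere_homotopic k Y (f x) (f \<circ> a) (f \<circ> a') \<longrightarrow>
           pointed_sphere_homotopic k X x a a') \<and>
        (\<forall>b. pointed_sphere_map k Y (f x) b \<longrightarrow>
           (\<exists>a. pointed_sphere_map k X x a \<and>
              pointed_sphere_homotopic k Y (f x) (f \<circ> a) b)))"


section \<open>Representations\<close>

definition orthogonal_rep :: "('g, 'm) monoid_scheme \<Rightarrow> ('g \<Rightarrow> 'v::real_inner \<Rightarrow> 'v) \<Rightarrow> bool" where
  "orthogonal_rep G \<rho> \<longleftrightarrow>
     group_action G UNIV \<rho> \<and> (\<forall>g\<in>carrier G. orthogonal_transformation (\<rho> g))"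

definition fd_subreps :: "('g, 'm) monoid_scheme \<Rightarrow> ('g \<Rightarrow> 'v::real_inner \<Rightarrow> 'v) \<Rightarrow> 'v set set" where
  "fd_subreps G \<rho> =
     {W. subspace W \<and> (\<exists>B. finite B \<and> W = span B) \<and> (\<forall>g\<in>carrier G. \<rho> g ` W \<subseteq> W)}"


section \<open>The little disks operad of a representation\<close>

text \<open>
  The pair \<open>(r, c)\<close> encodes the affine map \<open>x \<mapsto> r x + c\<close>.  On \<open>W = {0}\<close> there is just one affine
  self-map of the disk, whatever \<open>r\<close>; it is represented by \<open>r = 1\<close>.  In this way pairs correspond
  bijectively to affine maps for every \<open>W\<close>, and the same pair is a little disk in every larger
  subrepresentation (see \<open>little_disk_unique\<close> and \<open>disk_tuples_mono\<close>).
\<close>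

type_synonym 'v disk = "real \<times> 'v"

definition disk_map :: "'v::real_inner disk \<Rightarrow> 'v \<Rightarrow> 'v" where
  "disk_map d x = fst d *\<^sub>R x + snd d"

definition little_disk :: "'v::real_inner set \<Rightarrow> 'v disk \<Rightarrow> bool" where
  "little_disk W d \<longleftrightarrow> fst d > 0 \<and> snd d \<in> W \<and>
     disk_map d ` (cball 0 1 \<inter> W) \<subseteq> cball 0 1 \<inter> W \<and> (W = {0} \<longrightarrow> fst d = 1)"

definition disk_tuples :: "'v::real_inner set \<Rightarrow> nat \<Rightarrow> (nat \<Rightarrow> 'v disk) set" where
  "disk_tuples W n = {d \<in> {1..n} \<rightarrow>\<^sub>E Collect (little_disk W).
     \<forall>i\<in>{1..n}. \<forall>j\<in>{1..n}. i \<noteq> j \<longrightarrow>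
       disk_map (d i) ` (ball 0 1 \<inter> W) \<inter> disk_map (d j) ` (ball 0 1 \<inter> W) = {}}"

definition disk_space_in :: "'v::real_inner set \<Rightarrow> nat \<Rightarrow> (nat \<Rightarrow> 'v disk) topology" where
  "disk_space_in W n = subtopology (product_topology (\<lambda>_. euclidean) {1..n}) (disk_tuples W n)"

definition disk_space ::
  "('g, 'm) monoid_scheme \<Rightarrow> ('g \<Rightarrow> 'v::real_inner \<Rightarrow> 'v) \<Rightarrow> nat \<Rightarrow> (nat \<Rightarrow> 'v disk) topology" where
  "disk_space G \<rho> n = union_topology (fd_subreps G \<rho>) (\<lambda>W. disk_space_in W n)"

lemma little_disk_unique:
  assumes "subspace W" "little_disk W d" "little_disk W d'"
    and eq: "\<And>x. x \<in> cball 0 1 \<inter> W \<Longrightarrow> disk_map d x = disk_map d' x"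
  shows "d = d'"
proof -
  have c: "snd d = snd d'"
    using eq[of 0] \<open>subspace W\<close> by (simp add: disk_map_def subspace_0)
  have "fst d = fst d'"
  proof (cases "W = {0}")
    case True
    then show ?thesis using assms by (simp add: little_disk_def)
  next
    case False
    then obtain w where w: "w \<in> W" "w \<noteq> 0" using \<open>subspace W\<close> subspace_0 by blast
    then have "(1 / norm w) *\<^sub>R w \<in> cball 0 1 \<inter> W"
      using \<open>subspace W\<close> by (simp add: subspace_scale)
    from eq[OF this] c w show ?thesis by (simp add: disk_map_def)
  qed
  with c show ?thesis by (simp add: prod_eq_iff)
qed

lemma little_disk_iff:
  assumes "subspace W" "W \<noteq> {0}"
  shows "little_disk W d \<longleftrightarrow> fst d > 0 \<and> snd d \<in> W \<and> fst d + norm (snd d) \<le> 1"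
proof
  assume L: "little_disk W d"
  then have r: "fst d > 0" and c: "snd d \<in> W" by (auto simp: little_disk_def)
  have "\<exists>x\<in>W. norm x = 1 \<and> norm (disk_map d x) = fst d + norm (snd d)"
  proof (cases "snd d = 0")
    case True
    obtain w where w: "w \<in> W" "w \<noteq> 0" using assms subspace_0 by blast
    then show ?thesis
      using assms True r
      by (intro bexI[of _ "(1 / norm w) *\<^sub>R w"]) (auto simp: disk_map_def subspace_scale)
  next
    case False
    define x where "x = (1 / norm (snd d)) *\<^sub>R snd d"
    have "disk_map d x = (fst d / norm (snd d) + 1) *\<^sub>R snd d"
      by (simp add: disk_map_def x_def scaleR_add_left)
    then have "norm (disk_map d x) = \<bar>fst d / norm (snd d) + 1\<bar> * norm (snd d)" by simp
    also have "\<dots> = fst d + norm (snd d)"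
      using False r by (simp add: field_simps abs_of_nonneg add_nonneg_nonneg)
    finally show ?thesis
      using False c assms by (intro bexI[of _ x]) (auto simp: x_def subspace_scale)
  qed
  then show "fst d > 0 \<and> snd d \<in> W \<and> fst d + norm (snd d) \<le> 1"
    using L r c by (force simp: little_disk_def)
next
  assume R: "fst d > 0 \<and> snd d \<in> W \<and> fst d + norm (snd d) \<le> 1"
  have "disk_map d x \<in> cball 0 1 \<inter> W" if "x \<in> cball 0 1 \<inter> W" for x
  proof -
    have "norm (disk_map d x) \<le> fst d * norm x + norm (snd d)"
      unfolding disk_map_def using R norm_triangle_ineq[of "fst d *\<^sub>R x" "snd d"] by simp
    also have "\<dots> \<le> fst d * 1 + norm (snd d)"
      using that R by (intro add_right_mono mult_left_mono) auto
    finally have "norm (disk_map d x) \<le> 1" using R by simp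
    moreover have "disk_map d x \<in> W"
      using that R assms by (auto simp: disk_map_def intro: subspace_add subspace_scale)
    ultimately show ?thesis by simp
  qed
  then show "little_disk W d" using R assms by (auto simp: little_disk_def)
qed

lemma disk_disjoint_iff:
  assumes "subspace W" "little_disk W d" "little_disk W d'"
  shows "disk_map d ` (ball 0 1 \<inter> W) \<inter> disk_map d' ` (ball 0 1 \<inter> W) = {} \<longleftrightarrow>
         fst d + fst d' \<le> dist (snd d) (snd d')"
proof -
  have pos: "fst d > 0" "fst d' > 0" and cW: "snd d \<in> W" "snd d' \<in> W"
    using assms by (auto simp: little_disk_def)
  define s where "s = fst d + fst d'"
  have s: "s > 0" using pos by (simp add: s_def)
  define v where "v = (1 / s) *\<^sub>R (snd d' - snd d)"
  show ?thesis
  proof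
    assume E: "disk_map d ` (ball 0 1 \<inter> W) \<inter> disk_map d' ` (ball 0 1 \<inter> W) = {}"
    show "fst d + fst d' \<le> dist (snd d) (snd d')"
    proof (rule ccontr)
      assume "\<not> ?thesis"
      then have "norm (snd d' - snd d) < s" by (simp add: s_def dist_norm norm_minus_commute)
      then have v1: "norm v < 1" using s by (simp add: v_def)
      have vW: "v \<in> W" using assms cW by (simp add: v_def subspace_scale subspace_diff)
      have "s *\<^sub>R v = snd d' - snd d" using s by (simp add: v_def)
      then have "fst d *\<^sub>R v + snd d = fst d' *\<^sub>R (- v) + snd d'"
        by (simp add: s_def scaleR_add_left algebra_simps)
      moreover have "- v \<in> ball 0 1 \<inter> W" "v \<in> ball 0 1 \<inter> W"
        using v1 vW assms by (auto simp: subspace_neg)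
      ultimately show False using E unfolding disk_map_def by blast
    qed
  next
    assume L: "fst d + fst d' \<le> dist (snd d) (snd d')"
    have False if "norm x < 1" "norm y < 1" "disk_map d x = disk_map d' y" for x y
    proof -
      have "snd d - snd d' = fst d' *\<^sub>R y - fst d *\<^sub>R x"
        using that(3) by (simp add: disk_map_def algebra_simps)
      then have "dist (snd d) (snd d') \<le> fst d' * norm y + fst d * norm x"
        using norm_triangle_ineq4[of "fst d' *\<^sub>R y" "fst d *\<^sub>R x"] pos by (simp add: dist_norm)
      also have "\<dots> < fst d' * 1 + fst d * 1"
        using that pos by (intro add_strict_mono mult_strict_left_mono) auto
      finally show False using L by simp
    qed
    then show "disk_map d ` (ball 0 1 \<inter> W) \<inter> disk_map d' ` (ball 0 1 \<inter> W) = {}"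
      by force
  qed
qed

lemma little_disk_mono:
  assumes "subspace W" "subspace W'" "W \<subseteq> W'" "little_disk W d"
  shows "little_disk W' d"
proof (cases "W = {0}")
  case True
  then have "d = (1, 0)" using assms by (auto simp: little_disk_def prod_eq_iff)
  then show ?thesis using assms by (auto simp: little_disk_def disk_map_def subspace_0)
next
  case False
  then have "W' \<noteq> {0}" using assms subspace_0 by blast
  then show ?thesis using assms False by (auto simp: little_disk_iff)
qed

lemma disk_tuples_mono:
  assumes "subspace W" "subspace W'" "W \<subseteq> W'"
  shows "disk_tuples W n \<subseteq> disk_tuples W' n"
proof
  fix d assume d: "d \<in> disk_tuples W n"
  then have LW: "little_disk W (d i)" if "i \<in> {1..n}" for i
    using that by (auto simp: disk_tuples_def)
  with little_disk_mono[OF assms] have L: "little_disk W (d i)" "little_disk W' (d i)"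
    if "i \<in> {1..n}" for i
    using that by blast+
  have "d \<in> {1..n} \<rightarrow>\<^sub>E Collect (little_disk W')"
    using d L by (auto simp: disk_tuples_def PiE_iff)
  with d show "d \<in> disk_tuples W' n"
    using L by (simp add: disk_tuples_def disk_disjoint_iff[OF assms(1)] disk_disjoint_iff[OF assms(2)])
qed

definition disk_conj :: "('g \<Rightarrow> 'v::real_inner \<Rightarrow> 'v) \<Rightarrow> 'g \<Rightarrow> 'v disk \<Rightarrow> 'v disk" where
  "disk_conj \<rho> g d = (fst d, \<rho> g (snd d))"

lemma disk_map_conj:
  assumes "orthogonal_rep G \<rho>" "g \<in> carrier G"
  shows "disk_map (disk_conj \<rho> g d) x = \<rho> g (disk_map d (\<rho> (m_inv G g) x))"
proof -
  interpret group_action G UNIV \<rho> using assms by (simp add: orthogonal_rep_def)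
  have "linear (\<rho> g)" using assms by (simp add: orthogonal_rep_def orthogonal_transformation_def)
  moreover have "\<rho> g (\<rho> (m_inv G g) x) = x"
    using assms(2) by (metis UNIV_I group.inv_closed group.inv_inv group_hom group_hom.axioms(1)
        orbit_sym_aux)
  ultimately show ?thesis
    by (simp add: disk_map_def disk_conj_def linear_add linear_scale)
qed

definition disk_comp :: "'v::real_inner disk \<Rightarrow> 'v disk \<Rightarrow> 'v disk" where
  "disk_comp d e = (fst d * fst e, fst d *\<^sub>R snd e + snd d)"

lemma disk_map_comp: "disk_map (disk_comp d e) = disk_map d \<circ> disk_map e"
  by (rule ext) (simp add: disk_map_def disk_comp_def algebra_simps)

text \<open>
  The left action of \<open>G \<times> \<Sigma>\<^sub>n\<close> on \<open>n\<close>-tuples, for a given action of \<open>G\<close> on the entries.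
\<close>

definition tuple_act ::
  "('g \<Rightarrow> 'a \<Rightarrow> 'a) \<Rightarrow> nat \<Rightarrow> 'g \<times> (nat \<Rightarrow> nat) \<Rightarrow> (nat \<Rightarrow> 'a) \<Rightarrow> (nat \<Rightarrow> 'a)" where
  "tuple_act \<alpha> n k x = (\<lambda>i\<in>{1..n}. \<alpha> (fst k) (x (inv_into UNIV (snd k) i)))"

text \<open>
  Positions \<open>1, \<dots>, n\<^sub>1 + \<dots> + n\<^sub>k\<close> are cut into consecutive blocks of lengths \<open>n\<^sub>1, \<dots>, n\<^sub>k\<close>;
  position \<open>m\<close> is the \<open>block_offset ns m\<close>-th one in block \<open>block_index ns m\<close>.
\<close>

definition block_index :: "(nat \<Rightarrow> nat) \<Rightarrow> nat \<Rightarrow> nat" where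
  "block_index ns m = (LEAST i. m \<le> sum ns {1..i})"

definition block_offset :: "(nat \<Rightarrow> nat) \<Rightarrow> nat \<Rightarrow> nat" where
  "block_offset ns m = m - sum ns {1..<block_index ns m}"

definition block_concat :: "nat \<Rightarrow> (nat \<Rightarrow> nat) \<Rightarrow> (nat \<Rightarrow> nat \<Rightarrow> 'a) \<Rightarrow> (nat \<Rightarrow> 'a)" where
  "block_concat k ns x = (\<lambda>m\<in>{1..sum ns {1..k}}. x (block_index ns m) (block_offset ns m))"

lemma block_concat_eq:
  assumes "i \<in> {1..k}" "j \<in> {1..ns i}"
  shows "block_concat k ns x (sum ns {1..<i} + j) = x i j"
proof -
  let ?m = "sum ns {1..<i} + j"
  have *: "sum ns {1..i} = sum ns {1..<i} + ns i"
    using assms by (metis add.commute atLeastAtMost_iff sum.last_plus)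
  have "block_index ns ?m = i"
    unfolding block_index_def
  proof (rule Least_equality)
    show "?m \<le> sum ns {1..i}" using * assms by simp
    fix l assume l: "?m \<le> sum ns {1..l}"
    show "i \<le> l"
    proof (rule ccontr)
      assume "\<not> i \<le> l"
      then have "sum ns {1..l} \<le> sum ns {1..<i}" by (intro sum_mono2) auto
      with l assms show False by simp
    qed
  qed
  moreover have "sum ns {1..i} \<le> sum ns {1..k}" using assms by (intro sum_mono2) auto
  ultimately show ?thesis
    using * assms by (simp add: block_concat_def block_offset_def)
qed

definition operad_unit :: "nat \<Rightarrow> 'v::real_inner disk" where
  "operad_unit = (\<lambda>i\<in>{1..1}. (1, 0))"

definition operad_comp ::
  "nat \<Rightarrow> (nat \<Rightarrow> nat) \<Rightarrow> (nat \<Rightarrow> 'v::real_inner disk) \<Rightarrow> (nat \<Rightarrow> nat \<Rightarrow> 'v disk) \<Rightarrow> (nat \<Rightarrow> 'v disk)" where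
  "operad_comp k ns d e = block_concat k ns (\<lambda>i j. disk_comp (d i) (e i j))"


section \<open>Algebras over the little disks operad\<close>

definition G_space :: "('g, 'm) monoid_scheme \<Rightarrow> 'x topology \<Rightarrow> ('g \<Rightarrow> 'x \<Rightarrow> 'x) \<Rightarrow> bool" where
  "G_space G X \<alpha> \<longleftrightarrow>
     group_action G (topspace X) \<alpha> \<and> (\<forall>g\<in>carrier G. continuous_map X X (\<alpha> g))"

text \<open>
  \<open>\<theta> n\<close> is the structure map \<open>\<D>(V)\<^sub>n \<times> X\<^sup>n \<rightarrow> X\<close>.  Invariance under the diagonal action of
  \<open>\<Sigma>\<^sub>n\<close>, equivalently factoring through the orbit space of \<open>\<D>(V)\<^sub>n \<times> X\<^sup>n\<close>, and equivariance
  under the diagonal action of \<open>G\<close> are expressed together.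
\<close>

definition disks_algebra ::
  "('g, 'm) monoid_scheme \<Rightarrow> ('g \<Rightarrow> 'v::real_inner \<Rightarrow> 'v) \<Rightarrow> 'x topology \<Rightarrow> ('g \<Rightarrow> 'x \<Rightarrow> 'x) \<Rightarrow>
   (nat \<Rightarrow> (nat \<Rightarrow> 'v disk) \<Rightarrow> (nat \<Rightarrow> 'x) \<Rightarrow> 'x) \<Rightarrow> bool" where
  "disks_algebra G \<rho> X \<alpha> \<theta> \<longleftrightarrow>
     G_space G X \<alpha> \<and>
     (\<forall>n. continuous_map
            (prod_topology (disk_space G \<rho> n) (product_topology (\<lambda>_. X) {1..n})) X
            (\<lambda>(d, x). \<theta> n d x)) \<and>
     (\<forall>n. \<forall>g\<in>carrier G. \<forall>\<sigma>\<in>carrier (sym_group n).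
        \<forall>d\<in>topspace (disk_space G \<rho> n). \<forall>x\<in>{1..n} \<rightarrow>\<^sub>E topspace X.
          \<theta> n (tuple_act (disk_conj \<rho>) n (g, \<sigma>) d) (tuple_act \<alpha> n (g, \<sigma>) x) = \<alpha> g (\<theta> n d x)) \<and>
     (\<forall>x\<in>{1..1} \<rightarrow>\<^sub>E topspace X. \<theta> 1 operad_unit x = x 1) \<and>
     (\<forall>k ns d e x.
        d \<in> topspace (disk_space G \<rho> k) \<and>
        (\<forall>i\<in>{1..k}. e i \<in> topspace (disk_space G \<rho> (ns i))) \<and>
        (\<forall>i\<in>{1..k}. x i \<in> {1..ns i} \<rightarrow>\<^sub>E topspace X) \<longrightarrow>
        \<theta> (sum ns {1..k}) (operad_comp k ns d e) (block_concat k ns x) =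
          \<theta> k d (\<lambda>i\<in>{1..k}. \<theta> (ns i) (e i) (x i)))"


section \<open>Finite \<open>H\<close>-sets\<close>

text \<open>
  In the rest of this theory \<open>\<tau>\<close> is the action of a subgroup \<open>H\<close> on a finite set \<open>T\<close> of
  cardinality \<open>n\<close>, and an ordering of \<open>T\<close> is a bijection \<open>ord\<close> from \<open>{1..n}\<close> to \<open>T\<close>.
\<close>

definition embeddings_in ::
  "'g set \<Rightarrow> ('g \<Rightarrow> 'v::real_inner \<Rightarrow> 'v) \<Rightarrow> 't set \<Rightarrow> ('g \<Rightarrow> 't \<Rightarrow> 't) \<Rightarrow> 'v set \<Rightarrow> ('t \<Rightarrow> 'v) set" where
  "embeddings_in H \<rho> T \<tau> W =
     {f \<in> T \<rightarrow>\<^sub>E W. inj_on f T \<and> (\<forall>h\<in>H. \<forall>t\<in>T. f (\<tau> h t) = \<rho> h (f t))}"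

text \<open>
  Like the operad, \<open>V\<close> and its embedding spaces carry the colimit topology over the finite
  dimensional subrepresentations; for finite dimensional \<open>V\<close> this is the usual topology.
\<close>

definition embedding_space ::
  "('g, 'm) monoid_scheme \<Rightarrow> ('g \<Rightarrow> 'v::real_inner \<Rightarrow> 'v) \<Rightarrow>
   'g set \<Rightarrow> 't set \<Rightarrow> ('g \<Rightarrow> 't \<Rightarrow> 't) \<Rightarrow> ('t \<Rightarrow> 'v) topology" where
  "embedding_space G \<rho> H T \<tau> = union_topology (fd_subreps G \<rho>)
     (\<lambda>W. subtopology (product_topology (\<lambda>_. euclidean) T) (embeddings_in H \<rho> T \<tau> W))"

definition ordering_hom ::
  "'t set \<Rightarrow> ('g \<Rightarrow> 't \<Rightarrow> 't) \<Rightarrow> (nat \<Rightarrow> 't) \<Rightarrow> 'g \<Rightarrow> (nat \<Rightarrow> nat)" where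
  "ordering_hom T \<tau> ord h =
     (\<lambda>i. if i \<in> {1..card T} then inv_into {1..card T} ord (\<tau> h (ord i)) else i)"

definition graph_subgroup ::
  "'g set \<Rightarrow> 't set \<Rightarrow> ('g \<Rightarrow> 't \<Rightarrow> 't) \<Rightarrow> (nat \<Rightarrow> 't) \<Rightarrow> ('g \<times> (nat \<Rightarrow> nat)) set" where
  "graph_subgroup H T \<tau> ord = {(h, ordering_hom T \<tau> ord h) | h. h \<in> H}"

definition disk_fixed_space ::
  "('g, 'm) monoid_scheme \<Rightarrow> ('g \<Rightarrow> 'v::real_inner \<Rightarrow> 'v) \<Rightarrow> nat \<Rightarrow>
   ('g \<times> (nat \<Rightarrow> nat)) set \<Rightarrow> (nat \<Rightarrow> 'v disk) topology" where
  "disk_fixed_space G \<rho> n K =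
     subtopology (disk_space G \<rho> n) {d. \<forall>k\<in>K. tuple_act (disk_conj \<rho>) n k d = d}"

definition centers :: "'t set \<Rightarrow> (nat \<Rightarrow> 't) \<Rightarrow> (nat \<Rightarrow> 'v::real_inner disk) \<Rightarrow> ('t \<Rightarrow> 'v)" where
  "centers T ord d = (\<lambda>t\<in>T. snd (d (inv_into {1..card T} ord t)))"

definition map_space :: "'t set \<Rightarrow> 'x topology \<Rightarrow> ('t \<Rightarrow> 'x) topology" where
  "map_space T X = product_topology (\<lambda>_. X) T"

definition map_conj ::
  "('g, 'm) monoid_scheme \<Rightarrow> 't set \<Rightarrow> ('g \<Rightarrow> 't \<Rightarrow> 't) \<Rightarrow> ('g \<Rightarrow> 'x \<Rightarrow> 'x) \<Rightarrow> 'g \<Rightarrow> ('t \<Rightarrow> 'x) \<Rightarrow> ('t \<Rightarrow> 'x)" where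
  "map_conj G T \<tau> \<alpha> h f = (\<lambda>t\<in>T. \<alpha> h (f (\<tau> (m_inv G h) t)))"

definition multiplication ::
  "(nat \<Rightarrow> (nat \<Rightarrow> 'v::real_inner disk) \<Rightarrow> (nat \<Rightarrow> 'x) \<Rightarrow> 'x) \<Rightarrow> 't set \<Rightarrow> (nat \<Rightarrow> 't) \<Rightarrow>
   (nat \<Rightarrow> 'v disk) \<Rightarrow> ('t \<Rightarrow> 'x) \<Rightarrow> 'x" where
  "multiplication \<theta> T ord d f = \<theta> (card T) d (\<lambda>i\<in>{1..card T}. f (ord i))"

definition equivariant_map_to ::
  "('g, 'm) monoid_scheme \<Rightarrow> 'g set \<Rightarrow> 't set \<Rightarrow> ('g \<Rightarrow> 't \<Rightarrow> 't) \<Rightarrow>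
   'x topology \<Rightarrow> ('g \<Rightarrow> 'x \<Rightarrow> 'x) \<Rightarrow> (('t \<Rightarrow> 'x) \<Rightarrow> 'x) \<Rightarrow> bool" where
  "equivariant_map_to G H T \<tau> X \<alpha> \<mu> \<longleftrightarrow>
     continuous_map (map_space T X) X \<mu> \<and>
     (\<forall>h\<in>H. \<forall>f\<in>topspace (map_space T X). \<mu> (map_conj G T \<tau> \<alpha> h f) = \<alpha> h (\<mu> f))"

end

theory Submission
  imports Defs
begin

text \<open>
  A point \<open>d\<close> of \<open>\<D>(V)\<^sub>n\<close> that is fixed by the graph subgroup satisfies \<open>(h, \<phi>(h)) d = d\<close>, so the
  equivariance of the structure map under \<open>G \<times> \<Sigma>\<^sub>n\<close>, evaluated at \<open>(h, \<phi>(h))\<close>, says precisely that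
  \<open>\<theta>(d, -)\<close> is \<open>H\<close>-equivariant once \<open>X\<^sup>n\<close> is identified with \<open>Map(T, X)\<close> by the ordering.

  The substance is that taking centers is a weak equivalence \<open>p\<close> from the fixed tuples to the
  equivariant embeddings.  A tuple is determined by its centers and radii, and for given centers
  the admissible radii form a convex set, but the centers must lie inside the unit disk.  Hence
  fix \<open>H\<close>-invariant radii \<open>r\<close>, and send an embedding \<open>e\<close> to the tuple of disks of radii \<open>r\<close> around
  its points, made admissible by two continuous factors: one shrinks the whole picture into the
  unit disk, the other shrinks the radii until the disks no longer overlap (\<open>fitted_disks\<close>).
  This gives a map \<open>g\<^sub>r\<close> from embeddings to fixed tuples.  Both \<open>g\<^sub>r \<circ> p\<close> and \<open>p \<circ> g\<^sub>r\<close> change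
  the centers only by a positive factor, and along such a rescaling the admissible pairs of radii
  and centers are convex, so straight lines join both composites to the identity
  (\<open>homotopy_on_fixed_tuples\<close>, \<open>homotopy_on_embeddings\<close>).

  Homotopy groups need base points.  If \<open>r\<close> consists of the radii of a given fixed tuple \<open>d\<close>, then
  no shrinking takes place over \<open>p(d)\<close>, so \<open>g\<^sub>r(p(d)) = d\<close>, and the straight lines are constant at
  \<open>d\<close> and \<open>p(d)\<close>.  So every base point has its own pointed homotopy inverse, and no change of
  base point enters (\<open>weak_equivalence_if_pointed_inverses\<close>).

  The topologies are final ones on unions over subrepresentations.  Maps are constructed on each
  piece; that homotopies may be, too, rests on the compactness of the interval
  (\<open>continuous_map_from_prod_union_topology\<close>), and the fixed points of the union carry the
  final topology of the fixed points in the pieces because these are closed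
  (\<open>subtopology_union_topology\<close>).
\<close>


section \<open>Unions with the final topology\<close>

lemma continuous_map_into_union_topology:
  assumes "i \<in> I" "continuous_map Z (X i) f"
  shows "continuous_map Z (union_topology I X) f"
proof -
  have "openin Z {z \<in> topspace Z. f z \<in> U}" if "openin (union_topology I X) U" for U
  proof -
    have "openin (X i) (U \<inter> topspace (X i))"
      using that assms(1) by (simp add: openin_union_topology)
    then have "openin Z {z \<in> topspace Z. f z \<in> U \<inter> topspace (X i)}"
      by (rule openin_continuous_map_preimage[OF assms(2)])
    moreover have "{z \<in> topspace Z. f z \<in> U \<inter> topspace (X i)} = {z \<in> topspace Z. f z \<in> U}"
      using continuous_map_funspace[OF assms(2)] by auto
    ultimately show ?thesis by simp
  qed
  moreover have "f \<in> topspace Z \<rightarrow> topspace (union_topology I X)"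
    using continuous_map_funspace[OF assms(2)] assms(1) by (auto simp: topspace_union_topology)
  ultimately show ?thesis by (simp add: continuous_map_def)
qed

lemma continuous_map_from_union_topology:
  assumes "\<And>i. i \<in> I \<Longrightarrow> continuous_map (X i) Y f"
  shows "continuous_map (union_topology I X) Y f"
proof -
  have "openin (union_topology I X) {x \<in> topspace (union_topology I X). f x \<in> U}"
    if "openin Y U" for U
  proof -
    have "openin (X i) ({x \<in> topspace (union_topology I X). f x \<in> U} \<inter> topspace (X i))"
      if "i \<in> I" for i
    proof -
      have "openin (X i) {x \<in> topspace (X i). f x \<in> U}"
        using openin_continuous_map_preimage[OF assms[OF that] \<open>openin Y U\<close>] .
      moreover have "{x \<in> topspace (union_topology I X). f x \<in> U} \<inter> topspace (X i) =
          {x \<in> topspace (X i). f x \<in> U}"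
        using that by (auto simp: topspace_union_topology)
      ultimately show ?thesis by simp
    qed
    then show ?thesis by (auto simp: openin_union_topology topspace_union_topology)
  qed
  moreover have "f \<in> topspace (union_topology I X) \<rightarrow> topspace Y"
    using assms continuous_map_funspace by (fastforce simp: topspace_union_topology)
  ultimately show ?thesis by (simp add: continuous_map_def)
qed

text \<open>
  Whitehead's theorem that the product with a compact Hausdorff space preserves colimits, for
  unions.  The points \<open>x\<close> whose whole slice \<open>C \<times> {x}\<close> is mapped into a given open set form, by the
  tube lemma in every piece, an open set of the union; a compact neighbourhood \<open>C\<close> of a given
  parameter therefore yields the required product neighbourhood.  It is what makes homotopies on
  a union constructible piece by piece.
\<close>

lemma continuous_map_from_prod_union_topology:
  assumes K: "compact_space K" "Hausdorff_space K"
    and h: "\<And>i. i \<in> I \<Longrightarrow> continuous_map (prod_topology K (X i)) Y h"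
  shows "continuous_map (prod_topology K (union_topology I X)) Y h"
proof -
  let ?X = "union_topology I X"
  have "openin (prod_topology K ?X) {p \<in> topspace (prod_topology K ?X). h p \<in> U}"
    (is "openin _ ?P") if U: "openin Y U" for U
  proof (subst openin_prod_topology_alt, intro allI impI)
    fix z x assume "(z, x) \<in> ?P"
    then have z: "z \<in> topspace K" and hzx: "h (z, x) \<in> U" and "x \<in> topspace ?X" by auto
    then obtain i where i: "i \<in> I" "x \<in> topspace (X i)"
      by (auto simp: topspace_union_topology)
    have "continuous_map K Y (h \<circ> (\<lambda>z. (z, x)))"
      using i by (intro continuous_map_compose[OF _ h[OF i(1)]])
        (auto simp: continuous_map_pairwise o_def)
    then have N: "openin K {z \<in> topspace K. h (z, x) \<in> U}"
      using openin_continuous_map_preimage[OF _ U] by fastforce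
    have "regular_space K"
      using K compact_Hausdorff_imp_regular_space by blast
    then have "neighbourhood_base_of (closedin K) K"
      by (simp add: neighbourhood_base_of_closedin)
    with N z hzx obtain A C where A: "openin K A" "z \<in> A" and "closedin K C" "A \<subseteq> C"
      and CU: "C \<subseteq> {z \<in> topspace K. h (z, x) \<in> U}"
      unfolding neighbourhood_base_of by (metis (mono_tags, lifting) mem_Collect_eq)
    then have C: "compactin K C" using K closedin_compact_space by blast
    define B where "B = {y \<in> topspace ?X. \<forall>z\<in>C. h (z, y) \<in> U}"
    have "openin (X j) (B \<inter> topspace (X j))" if j: "j \<in> I" for j
    proof (subst openin_subopen, intro ballI)
      fix y assume y: "y \<in> B \<inter> topspace (X j)"
      let ?W = "{p \<in> topspace (prod_topology K (X j)). h p \<in> U}"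
      have "openin (prod_topology K (X j)) ?W"
        by (rule openin_continuous_map_preimage[OF h[OF j] U])
      moreover have "C \<times> {y} \<subseteq> ?W"
        using y CU by (auto simp: B_def)
      ultimately obtain S V where "openin (X j) V" "C \<subseteq> S" "y \<in> V" "S \<times> V \<subseteq> ?W"
        using tube_lemma_left[OF _ C, of "X j" ?W y] y by blast
      moreover have "V \<subseteq> B \<inter> topspace (X j)"
      proof
        fix v assume v: "v \<in> V"
        then have "v \<in> topspace (X j)" using \<open>openin (X j) V\<close> openin_subset by blast
        then show "v \<in> B \<inter> topspace (X j)"
          using v \<open>C \<subseteq> S\<close> \<open>S \<times> V \<subseteq> ?W\<close> j by (auto simp: B_def topspace_union_topology)
      qed
      ultimately show "\<exists>V. openin (X j) V \<and> y \<in> V \<and> V \<subseteq> B \<inter> topspace (X j)" by blast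
    qed
    then have "openin ?X B"
      by (auto simp: openin_union_topology B_def topspace_union_topology)
    moreover have "x \<in> B" using \<open>x \<in> topspace ?X\<close> CU by (auto simp: B_def)
    moreover have "A \<times> B \<subseteq> ?P"
      using \<open>A \<subseteq> C\<close> openin_subset[OF A(1)] by (auto simp: B_def)
    ultimately show "\<exists>A B. openin K A \<and> openin ?X B \<and> z \<in> A \<and> x \<in> B \<and> A \<times> B \<subseteq> ?P"
      using A by blast
  qed
  moreover have "h \<in> topspace (prod_topology K ?X) \<rightarrow> topspace Y"
    using h continuous_map_funspace by (fastforce simp: topspace_union_topology)
  ultimately show ?thesis by (simp add: continuous_map_def)
qed

text \<open>
  For an arbitrary subset \<open>S\<close> the right-hand side can have more open sets.  Closedness lets a set
  that is open in every \<open>X i \<inter> S\<close> be enlarged by the complement of \<open>S\<close> to an open set of the union.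
\<close>

lemma subtopology_union_topology:
  assumes "\<And>i. i \<in> I \<Longrightarrow> closedin (X i) (topspace (X i) \<inter> S)"
  shows "subtopology (union_topology I X) S = union_topology I (\<lambda>i. subtopology (X i) S)"
proof (rule topology_eq[THEN iffD2], intro allI iffI)
  fix U assume "openin (subtopology (union_topology I X) S) U"
  then obtain V where V: "openin (union_topology I X) V" and U: "U = V \<inter> S"
    by (auto simp: openin_subtopology)
  have "openin (subtopology (X i) S) (U \<inter> topspace (subtopology (X i) S))" if "i \<in> I" for i
  proof -
    have "openin (X i) (V \<inter> topspace (X i))" using V that by (simp add: openin_union_topology)
    moreover have "U \<inter> topspace (subtopology (X i) S) = (V \<inter> topspace (X i)) \<inter> S"
      using U by auto
    ultimately show ?thesis by (auto simp: openin_subtopology)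
  qed
  then show "openin (union_topology I (\<lambda>i. subtopology (X i) S)) U"
    using V U by (auto simp: openin_union_topology)
next
  fix U assume U: "openin (union_topology I (\<lambda>i. subtopology (X i) S)) U"
  define V where "V = U \<union> ((\<Union>i\<in>I. topspace (X i)) - S)"
  have US: "U \<subseteq> (\<Union>i\<in>I. topspace (X i)) \<inter> S"
    using U by (auto simp: openin_union_topology)
  have "openin (X i) (V \<inter> topspace (X i))" if i: "i \<in> I" for i
  proof -
    obtain O' where O': "openin (X i) O'" "U \<inter> topspace (X i) = O' \<inter> S"
    proof -
      have "openin (subtopology (X i) S) (U \<inter> (topspace (X i) \<inter> S))"
        using U i by (simp add: openin_union_topology)
      moreover have "U \<inter> (topspace (X i) \<inter> S) = U \<inter> topspace (X i)" using US by blast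
      ultimately show ?thesis using that by (auto simp: openin_subtopology)
    qed
    have "V \<inter> topspace (X i) = O' \<union> (topspace (X i) - topspace (X i) \<inter> S)"
      using O' openin_subset[OF O'(1)] US i by (auto simp: V_def)
    moreover have "openin (X i) (topspace (X i) - topspace (X i) \<inter> S)"
      using assms[OF i] by (simp add: closedin_def)
    ultimately show ?thesis using O' by auto
  qed
  then have "openin (union_topology I X) V"
    using US by (auto simp: openin_union_topology V_def)
  moreover have "U = V \<inter> S" using US by (auto simp: V_def)
  ultimately show "openin (subtopology (union_topology I X) S) U"
    by (auto simp: openin_subtopology)
qed


section \<open>Weak equivalences from pointed homotopy inverses\<close>

lemma homotopic_with_path_component_of:
  assumes "homotopic_with P X Y f g" "x \<in> topspace X"
  shows "path_component_of Y (f x) (g x)"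
proof -
  obtain h where h: "continuous_map (prod_topology (top_of_set {0..1}) X) Y h"
    "\<And>x. h (0::real, x) = f x" "\<And>x. h (1, x) = g x"
    using assms by (auto simp: homotopic_with_def)
  have "continuous_map (top_of_set {0..1}) Y (h \<circ> (\<lambda>t. (t, x)))"
    using assms(2) by (intro continuous_map_compose[OF _ h(1)])
      (auto simp: continuous_map_pairwise o_def)
  then show ?thesis
    using h by (auto simp: path_component_of_def pathin_def o_def)
qed

text \<open>
  A homotopy inverse whose homotopies move base points would only give bijections on homotopy
  groups after a change of base point.  Here every \<open>x\<close> has an inverse of its own with homotopies
  that fix \<open>x\<close> and \<open>f x\<close>, so composition with it inverts \<open>f\<close> on pointed homotopy classes.
\<close>

lemma weak_equivalence_if_pointed_inverses:
  assumes f: "continuous_map X Y f"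
    and inverse: "\<And>x. x \<in> topspace X \<Longrightarrow> \<exists>g. continuous_map Y X g \<and> g (f x) = x \<and>
      homotopic_with (\<lambda>k. k x = x) X X (g \<circ> f) id \<and>
      homotopic_with (\<lambda>k. k (f x) = f x) Y Y (f \<circ> g) id"
    and surj: "\<And>y. y \<in> topspace Y \<Longrightarrow> \<exists>x\<in>topspace X. path_component_of Y (f x) y"
  shows "weak_equivalence X Y f"
  unfolding weak_equivalence_def
proof (intro conjI ballI allI impI)
  show "continuous_map X Y f" by fact
  show "\<exists>x\<in>topspace X. path_component_of Y (f x) y" if "y \<in> topspace Y" for y
    using surj that .
next
  fix x x' assume x: "x \<in> topspace X" "x' \<in> topspace X" and p: "path_component_of Y (f x) (f x')"
  obtain g where g: "continuous_map Y X g" "g (f x) = x"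
    and hom: "homotopic_with (\<lambda>k. k x = x) X X (g \<circ> f) id"
    using inverse[OF x(1)] by blast
  obtain q where q: "pathin Y q" "q 0 = f x" "q 1 = f x'"
    using p by (auto simp: path_component_of_def)
  have "pathin X (g \<circ> q)"
    using q(1) g(1) by (auto simp: pathin_def intro: continuous_map_compose)
  then have "path_component_of X (g (f x)) (g (f x'))"
    unfolding path_component_of_def using q by (intro exI[of _ "g \<circ> q"]) simp
  moreover have "path_component_of X (g (f x')) x'"
    using homotopic_with_path_component_of[OF hom x(2)] by simp
  ultimately show "path_component_of X x x'"
    using g(2) path_component_of_trans by metis
next
  fix k :: nat and x a a'
  assume x: "x \<in> topspace X"
  assume A: "pointed_sphere_map k X x a \<and> pointed_sphere_map k X x a' \<and>
     pointed_sphere_homotopic k Y (f x) (f \<circ> a) (f \<circ> a')"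
  obtain g where g: "continuous_map Y X g" "g (f x) = x"
    and hom: "homotopic_with (\<lambda>k. k x = x) X X (g \<circ> f) id"
    using inverse[OF x] by blast
  have to_a: "homotopic_with (\<lambda>a. a sphere_base = x) (nsphere k) X (g \<circ> f \<circ> b) b"
    if "pointed_sphere_map k X x b" for b
    using homotopic_with_compose_continuous_map_right[OF hom, of "nsphere k" b
        "\<lambda>a. a sphere_base = x"] that
    by (simp add: pointed_sphere_map_def)
  have "homotopic_with (\<lambda>a. a sphere_base = f x) (nsphere k) Y (f \<circ> a) (f \<circ> a')"
    using A by (simp add: pointed_sphere_homotopic_def)
  then have "homotopic_with (\<lambda>a. a sphere_base = x) (nsphere k) X (g \<circ> (f \<circ> a)) (g \<circ> (f \<circ> a'))"
    by (rule homotopic_with_compose_continuous_map_left[OF _ g(1)]) (simp add: g(2))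
  then show "pointed_sphere_homotopic k X x a a'"
    unfolding pointed_sphere_homotopic_def
    using A to_a[of a, THEN homotopic_with_symD] to_a[of a']
    by (auto simp: comp_assoc intro: homotopic_with_trans)
next
  fix k :: nat and x b
  assume x: "x \<in> topspace X" and b: "pointed_sphere_map k Y (f x) b"
  obtain g where g: "continuous_map Y X g" "g (f x) = x"
    and hom: "homotopic_with (\<lambda>k. k (f x) = f x) Y Y (f \<circ> g) id"
    using inverse[OF x] by blast
  have "homotopic_with (\<lambda>a. a sphere_base = f x) (nsphere k) Y (f \<circ> g \<circ> b) (id \<circ> b)"
    using b by (intro homotopic_with_compose_continuous_map_right[OF hom])
      (auto simp: pointed_sphere_map_def)
  moreover have "pointed_sphere_map k X x (g \<circ> b)"
    using b g by (auto simp: pointed_sphere_map_def intro: continuous_map_compose)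
  ultimately show "\<exists>a. pointed_sphere_map k X x a \<and> pointed_sphere_homotopic k Y (f x) (f \<circ> a) b"
    by (auto simp: pointed_sphere_homotopic_def comp_assoc)
qed


section \<open>Filtered spaces of tuples of vectors\<close>

text \<open>
  Both the fixed tuples of disks, with vectors \<open>(r, c)\<close>, and the equivariant embeddings are spaces
  of this kind.
\<close>

definition filtered_tuples ::
  "'w set \<Rightarrow> 'i set \<Rightarrow> ('w \<Rightarrow> ('i \<Rightarrow> 'a::topological_space) set) \<Rightarrow> ('i \<Rightarrow> 'a) topology" where
  "filtered_tuples \<W> I S =
     union_topology \<W> (\<lambda>W. subtopology (product_topology (\<lambda>_. euclidean) I) (S W))"

lemma topspace_filtered_tuples:
  assumes "\<And>W. W \<in> \<W> \<Longrightarrow> S W \<subseteq> extensional I"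
  shows "topspace (filtered_tuples \<W> I S) = (\<Union>W\<in>\<W>. S W)"
  using assms by (auto simp: filtered_tuples_def topspace_union_topology PiE_def)

lemma continuous_map_filtered_tuples:
  assumes "\<And>W. W \<in> \<W> \<Longrightarrow>
      continuous_map (subtopology (product_topology (\<lambda>_. euclidean) I) (S W))
        (product_topology (\<lambda>_. euclidean) J) f"
    and "\<And>W. W \<in> \<W> \<Longrightarrow> \<exists>W'\<in>\<W>'. f \<in> S W \<rightarrow> S' W'"
  shows "continuous_map (filtered_tuples \<W> I S) (filtered_tuples \<W>' J S') f"
  unfolding filtered_tuples_def
proof (rule continuous_map_from_union_topology)
  fix W assume "W \<in> \<W>"
  with assms obtain W' where "W' \<in> \<W>'" "f \<in> S W \<rightarrow> S' W'" by blast
  with assms(1)[OF \<open>W \<in> \<W>\<close>] show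
    "continuous_map (subtopology (product_topology (\<lambda>_. euclidean) I) (S W))
      (union_topology \<W>' (\<lambda>W. subtopology (product_topology (\<lambda>_. euclidean) J) (S' W))) f"
    by (intro continuous_map_into_union_topology[of W']) (auto simp: continuous_map_in_subtopology)
qed

definition straight_line :: "'i set \<Rightarrow> real \<Rightarrow> ('i \<Rightarrow> 'a::real_vector) \<Rightarrow> ('i \<Rightarrow> 'a) \<Rightarrow> ('i \<Rightarrow> 'a)" where
  "straight_line I t x y = (\<lambda>i\<in>I. (1 - t) *\<^sub>R x i + t *\<^sub>R y i)"

lemma continuous_map_euclidean_iff_tendsto:
  "continuous_map X euclidean f \<longleftrightarrow> (\<forall>x\<in>topspace X. (f \<longlongrightarrow> f x) (atin X x))"
  by (simp add: continuous_map_atin)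

text \<open>
  The line from \<open>g x\<close> to \<open>x\<close> may leave the piece of \<open>x\<close>, but it has to stay in some piece that
  depends only on the piece of \<open>x\<close>.  Where \<open>g\<close> already fixes \<open>x\<close> the line is constant, which is what
  makes the homotopy pointed at every fixed point of \<open>g\<close> at once.
\<close>

lemma straight_line_homotopy:
  fixes S :: "'w \<Rightarrow> ('i \<Rightarrow> 'a::real_normed_vector) set"
  assumes S: "\<And>W. W \<in> \<W> \<Longrightarrow> S W \<subseteq> extensional I"
    and g: "\<And>W. W \<in> \<W> \<Longrightarrow>
      continuous_map (subtopology (product_topology (\<lambda>_. euclidean) I) (S W))
        (product_topology (\<lambda>_. euclidean) I) g"
    and line: "\<And>W. W \<in> \<W> \<Longrightarrow>
      \<exists>W'\<in>\<W>. \<forall>x\<in>S W. \<forall>t\<in>{0..1}. straight_line I t (g x) x \<in> S W'"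
  shows "homotopic_with (\<lambda>k. \<forall>x\<in>topspace (filtered_tuples \<W> I S). g x = x \<longrightarrow> k x = x)
    (filtered_tuples \<W> I S) (filtered_tuples \<W> I S) g id"
proof -
  let ?P = "product_topology (\<lambda>_::'i. euclidean :: 'a topology) I"
  let ?X = "filtered_tuples \<W> I S"
  let ?h = "\<lambda>(t, x). straight_line I t (g x) x"
  have top: "topspace ?X = (\<Union>W\<in>\<W>. S W)" by (rule topspace_filtered_tuples[OF S])
  have "continuous_map (prod_topology (top_of_set {0..1}) ?X) ?X ?h"
    unfolding filtered_tuples_def
  proof (rule continuous_map_from_prod_union_topology)
    show "compact_space (top_of_set {0..1::real})" by (simp add: compact_space_subtopology)
    show "Hausdorff_space (top_of_set {0..1::real})"
      by (simp add: Hausdorff_space_subtopology)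
    fix W assume W: "W \<in> \<W>"
    then obtain W' where W': "W' \<in> \<W>" "\<And>x t. x \<in> S W \<Longrightarrow> t \<in> {0..1} \<Longrightarrow> straight_line I t (g x) x \<in> S W'"
      using line by blast
    let ?Z = "prod_topology (top_of_set {0..1}) (subtopology ?P (S W))"
    have "continuous_map ?Z ?P ?h"
      unfolding continuous_map_componentwise
    proof (intro conjI ballI)
      show "?h ` topspace ?Z \<subseteq> extensional I" by (auto simp: straight_line_def)
      fix i assume i: "i \<in> I"
      have "continuous_map ?Z euclidean (\<lambda>p. fst p)"
        using continuous_map_fst continuous_map_into_fulltopology by blast
      moreover have "continuous_map ?Z euclidean (\<lambda>p. snd p i)"
        using continuous_map_compose[OF continuous_map_snd
            continuous_map_from_subtopology[OF continuous_map_product_projection[OF i]]]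
        by (simp add: o_def)
      moreover have "continuous_map ?Z euclidean (\<lambda>p. g (snd p) i)"
        using continuous_map_compose[OF continuous_map_compose[OF continuous_map_snd g[OF W]]
            continuous_map_product_projection[OF i]]
        by (simp add: o_def)
      ultimately have "continuous_map ?Z euclidean
          (\<lambda>p. (1 - fst p) *\<^sub>R g (snd p) i + fst p *\<^sub>R snd p i)"
        unfolding continuous_map_euclidean_iff_tendsto by (auto intro!: tendsto_intros)
      then show "continuous_map ?Z euclidean (\<lambda>p. ?h p i)"
        using i by (simp add: straight_line_def case_prod_beta)
    qed
    then show "continuous_map ?Z
        (union_topology \<W> (\<lambda>W. subtopology ?P (S W))) ?h"
      using W' by (intro continuous_map_into_union_topology[of W'])
        (auto simp: continuous_map_in_subtopology)
  qed
  moreover have "straight_line I 0 (g x) x = g x" if "x \<in> topspace ?X" for x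
  proof -
    obtain W where W: "W \<in> \<W>" "x \<in> S W" using \<open>x \<in> topspace ?X\<close> top by blast
    then have "x \<in> topspace (subtopology ?P (S W))" using S by (auto simp: PiE_def)
    then have "g x \<in> extensional I"
      using continuous_map_funspace[OF g[OF W(1)]] by (auto simp: PiE_def)
    then show ?thesis by (auto simp: straight_line_def extensional_def)
  qed
  moreover have "straight_line I 1 (g x) x = x" if "x \<in> topspace ?X" for x
    using that S unfolding top by (fastforce simp: straight_line_def extensional_def)
  moreover have "straight_line I t (g x) x = x" if "x \<in> topspace ?X" "g x = x" for x t
  proof -
    have "x \<in> extensional I" using that S unfolding top by blast
    then show ?thesis
      unfolding that(2) by (auto simp: straight_line_def extensional_def algebra_simps)
  qed
  ultimately show ?thesis
    by (subst homotopic_with) (auto intro!: exI[of _ ?h])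
qed


section \<open>Fitting disks around a configuration of points\<close>

lemma little_disk_iff_norm:
  assumes "subspace W"
  shows "little_disk W d \<longleftrightarrow>
    fst d > 0 \<and> snd d \<in> W \<and> fst d + norm (snd d) \<le> 1 \<and> (W = {0} \<longrightarrow> fst d = 1)"
proof (cases "W = {0}")
  case True
  then show ?thesis by (auto simp: little_disk_def disk_map_def)
next
  case False
  then show ?thesis using little_disk_iff[OF assms] by simp
qed

lemma disk_tuples_iff:
  assumes "subspace W"
  shows "d \<in> disk_tuples W n \<longleftrightarrow> d \<in> extensional {1..n} \<and>
    (\<forall>i\<in>{1..n}. fst (d i) > 0 \<and> snd (d i) \<in> W \<and> fst (d i) + norm (snd (d i)) \<le> 1 \<and>
      (W = {0} \<longrightarrow> fst (d i) = 1)) \<and>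
    (\<forall>i\<in>{1..n}. \<forall>j\<in>{1..n}. i \<noteq> j \<longrightarrow>
      fst (d i) + fst (d j) \<le> dist (snd (d i)) (snd (d j)))"
proof -
  have "d \<in> disk_tuples W n \<longleftrightarrow> d \<in> extensional {1..n} \<and> (\<forall>i\<in>{1..n}. little_disk W (d i)) \<and>
    (\<forall>i\<in>{1..n}. \<forall>j\<in>{1..n}. i \<noteq> j \<longrightarrow>
       fst (d i) + fst (d j) \<le> dist (snd (d i)) (snd (d j)))"
    (is "?lhs \<longleftrightarrow> ?rhs")
  proof (cases "d \<in> extensional {1..n} \<and> (\<forall>i\<in>{1..n}. little_disk W (d i))")
    case True
    then have "?lhs \<longleftrightarrow> (\<forall>i\<in>{1..n}. \<forall>j\<in>{1..n}. i \<noteq> j \<longrightarrow>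
        disk_map (d i) ` (ball 0 1 \<inter> W) \<inter> disk_map (d j) ` (ball 0 1 \<inter> W) = {})"
      by (auto simp: disk_tuples_def PiE_def)
    also have "\<dots> \<longleftrightarrow> ?rhs"
    proof -
      have "disk_map (d i) ` (ball 0 1 \<inter> W) \<inter> disk_map (d j) ` (ball 0 1 \<inter> W) = {} \<longleftrightarrow>
          fst (d i) + fst (d j) \<le> dist (snd (d i)) (snd (d j))"
        if "i \<in> {1..n}" "j \<in> {1..n}" for i j
        by (rule disk_disjoint_iff[OF assms]) (use True that in auto)
      then have "(\<forall>i\<in>{1..n}. \<forall>j\<in>{1..n}. i \<noteq> j \<longrightarrow>
          disk_map (d i) ` (ball 0 1 \<inter> W) \<inter> disk_map (d j) ` (ball 0 1 \<inter> W) = {}) \<longleftrightarrow>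
        (\<forall>i\<in>{1..n}. \<forall>j\<in>{1..n}. i \<noteq> j \<longrightarrow>
          fst (d i) + fst (d j) \<le> dist (snd (d i)) (snd (d j)))"
        by (intro ball_cong refl imp_cong) simp
      then show ?thesis using True by blast
    qed
    finally show ?thesis .
  next
    case False
    then show ?thesis by (auto simp: disk_tuples_def PiE_def Pi_iff)
  qed
  then show ?thesis unfolding little_disk_iff_norm[OF assms] .
qed

definition overflow :: "'i set \<Rightarrow> ('i \<Rightarrow> real) \<Rightarrow> ('i \<Rightarrow> 'v::real_normed_vector) \<Rightarrow> real" where
  "overflow I r c = 1 + (\<Sum>i\<in>I. max 0 (r i + norm (c i) - 1))"

definition crowding :: "'i set \<Rightarrow> ('i \<Rightarrow> real) \<Rightarrow> ('i \<Rightarrow> 'v::real_normed_vector) \<Rightarrow> real" where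
  "crowding I r c = 1 + (\<Sum>i\<in>I. \<Sum>j\<in>I - {i}. max 0 ((r i + r j) / dist (c i) (c j) - 1))"

text \<open>
  Dividing everything by the overflow brings the disks of radius \<open>r i\<close> around \<open>c i\<close> into the unit
  disk, and dividing the radii once more, by the crowding, makes them nonoverlapping.  Sums of
  positive parts, rather than maxima, keep both factors visibly continuous; both equal \<open>1\<close> if the
  given disks are already in place, and then nothing is changed.
\<close>

definition fitted_disks ::
  "'i set \<Rightarrow> ('i \<Rightarrow> real) \<Rightarrow> ('i \<Rightarrow> 'v::real_normed_vector) \<Rightarrow> ('i \<Rightarrow> real \<times> 'v)" where
  "fitted_disks I r c =
     (\<lambda>i\<in>I. (r i / (overflow I r c * crowding I r c), (1 / overflow I r c) *\<^sub>R c i))"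

lemma overflow_ge_1: "overflow I r c \<ge> 1"
  unfolding overflow_def by (simp add: sum_nonneg)

lemma crowding_ge_1: "crowding I r c \<ge> 1"
  unfolding crowding_def by (simp add: sum_nonneg)

lemma overflow_ge:
  assumes "finite I" "i \<in> I"
  shows "r i + norm (c i) \<le> overflow I r c"
proof -
  have "max 0 (r i + norm (c i) - 1) \<le> (\<Sum>i\<in>I. max 0 (r i + norm (c i) - 1))"
    using assms by (intro member_le_sum) auto
  then show ?thesis by (simp add: overflow_def)
qed

lemma crowding_ge:
  assumes "finite I" "i \<in> I" "j \<in> I" "i \<noteq> j"
  shows "(r i + r j) / dist (c i) (c j) \<le> crowding I r c"
proof -
  let ?m = "\<lambda>i j. max 0 ((r i + r j) / dist (c i) (c j) - 1)"
  have "?m i j \<le> (\<Sum>j\<in>I - {i}. ?m i j)"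
    using assms by (intro member_le_sum) auto
  also have "\<dots> \<le> (\<Sum>i\<in>I. \<Sum>j\<in>I - {i}. ?m i j)"
    using assms by (intro member_le_sum) (auto intro: sum_nonneg)
  finally show ?thesis by (simp add: crowding_def)
qed

lemma fitted_disks_cong:
  assumes "\<And>i. i \<in> I \<Longrightarrow> c i = c' i"
  shows "fitted_disks I r c = fitted_disks I r c'"
proof -
  have "overflow I r c = overflow I r c'"
    unfolding overflow_def using assms by (intro arg_cong2[where f = "(+)"] sum.cong refl) simp
  moreover have "crowding I r c = crowding I r c'"
    unfolding crowding_def using assms by (intro arg_cong2[where f = "(+)"] sum.cong refl) simp
  ultimately show ?thesis
    unfolding fitted_disks_def using assms by (intro restrict_ext) simp
qed

lemma fitted_disks_unchanged:
  assumes "d \<in> extensional I"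
    and "\<And>i. i \<in> I \<Longrightarrow> fst (d i) > 0 \<and> fst (d i) + norm (snd (d i)) \<le> 1"
    and "\<And>i j. i \<in> I \<Longrightarrow> j \<in> I \<Longrightarrow> i \<noteq> j \<Longrightarrow> fst (d i) + fst (d j) \<le> dist (snd (d i)) (snd (d j))"
  shows "fitted_disks I (\<lambda>i. fst (d i)) (\<lambda>i. snd (d i)) = d"
proof -
  have "overflow I (\<lambda>i. fst (d i)) (\<lambda>i. snd (d i)) = 1"
    unfolding overflow_def using assms(2) by (simp add: max_absorb1 cong: sum.cong)
  moreover have "(fst (d i) + fst (d j)) / dist (snd (d i)) (snd (d j)) \<le> 1"
    if "i \<in> I" "j \<in> I - {i}" for i j
    using assms(3)[of i j] assms(2)[of i] assms(2)[of j] that by (auto simp: divide_le_eq_1)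
  then have "crowding I (\<lambda>i. fst (d i)) (\<lambda>i. snd (d i)) = 1"
    unfolding crowding_def by (auto intro!: sum.neutral simp: max_absorb1)
  ultimately show ?thesis
    using assms(1) by (auto simp: fitted_disks_def extensional_def fun_eq_iff)
qed

lemma fitted_disks_in_disk_tuples:
  fixes c :: "nat \<Rightarrow> 'v::real_inner"
  assumes W: "subspace W" "W = {0} \<Longrightarrow> (UNIV :: 'v set) = {0}"
    and r: "\<And>i. i \<in> {1..n} \<Longrightarrow> r i > 0"
      "\<And>i. i \<in> {1..n} \<Longrightarrow> (UNIV :: 'v set) = {0} \<Longrightarrow> r i = 1"
    and c: "\<And>i. i \<in> {1..n} \<Longrightarrow> c i \<in> W" "inj_on c {1..n}"
  shows "fitted_disks {1..n} r c \<in> disk_tuples W n"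
proof -
  define A B where "A = overflow {1..n} r c" and "B = crowding {1..n} r c"
  have A: "A \<ge> 1" and B: "B \<ge> 1" by (simp_all add: A_def B_def overflow_ge_1 crowding_ge_1)
  have AB: "A * B > 0" using A B by simp
  have norm: "r i / (A * B) + norm ((1 / A) *\<^sub>R c i) \<le> 1" if i: "i \<in> {1..n}" for i
  proof -
    have "r i / (A * B) \<le> r i / A"
      using r(1)[OF i] A B AB by (intro divide_left_mono) auto
    then have "r i / (A * B) + norm ((1 / A) *\<^sub>R c i) \<le> (r i + norm (c i)) / A"
      using A by (simp add: add_divide_distrib)
    also have "\<dots> \<le> 1"
      using overflow_ge[of "{1..n}" i r c] i A by (simp add: A_def)
    finally show ?thesis .
  qed
  have disjoint: "r i / (A * B) + r j / (A * B) \<le> dist ((1 / A) *\<^sub>R c i) ((1 / A) *\<^sub>R c j)"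
    if i: "i \<in> {1..n}" "j \<in> {1..n}" "i \<noteq> j" for i j
  proof -
    have "dist (c i) (c j) > 0" using inj_onD[OF c(2) _ i(1,2)] i(3) by auto
    then have "r i + r j \<le> B * dist (c i) (c j)"
      using crowding_ge[of "{1..n}" i j r c] i by (simp add: B_def divide_le_eq)
    then have "(r i + r j) / (A * B) \<le> B * dist (c i) (c j) / (A * B)"
      using AB by (intro divide_right_mono) auto
    also have "\<dots> = dist (c i) (c j) / A" using A B by simp
    also have "\<dots> = dist ((1 / A) *\<^sub>R c i) ((1 / A) *\<^sub>R c j)"
      using A by (simp add: dist_norm flip: scaleR_diff_right)
    finally show ?thesis by (simp add: add_divide_distrib)
  qed
  \<comment> \<open>On \<open>{0}\<close> an injective configuration has at most one point, so no shrinking is called for.\<close>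
  have one: "r i / (A * B) = 1" if "W = {0}" "i \<in> {1..n}" for i
  proof -
    have r1: "r j = 1" if "j \<in> {1..n}" for j using W(2) r(2) \<open>W = {0}\<close> that by blast
    have c0: "c j = 0" if "j \<in> {1..n}" for j using c(1) \<open>W = {0}\<close> that by blast
    have single: "{1..n} - {j} = {}" if j: "j \<in> {1..n}" for j
    proof -
      have "l = j" if "l \<in> {1..n}" for l using inj_onD[OF c(2) _ that j] c0[OF that] c0[OF j] by simp
      then show ?thesis by blast
    qed
    have "(\<Sum>i = 1..n. \<Sum>j\<in>{1..n} - {i}. max 0 ((r i + r j) / dist (c i) (c j) - 1)) = 0"
    proof (rule sum.neutral, rule ballI)
      fix i assume "i \<in> {1..n}"
      then have "{1..n} - {i} = {}" by (rule single)
      then show "(\<Sum>j\<in>{1..n} - {i}. max 0 ((r i + r j) / dist (c i) (c j) - 1)) = 0"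
        by (simp only: sum.empty)
    qed
    then have "B = 1" by (simp add: B_def crowding_def)
    moreover have "(\<Sum>i = 1..n. max 0 (r i + norm (c i) - 1)) = 0"
      by (rule sum.neutral) (use r1 c0 in simp)
    then have "A = 1" by (simp add: A_def overflow_def)
    moreover have "r i = 1" using r1 that by blast
    ultimately have "A = 1" "B = 1" "r i = 1" by blast+
    then show ?thesis by simp
  qed
  show ?thesis
    unfolding disk_tuples_iff[OF W(1)] fitted_disks_def A_def[symmetric] B_def[symmetric]
    using r(1) c(1) norm disjoint one AB W(1) by (auto simp: subspace_scale simp del: atLeastAtMost_iff)
qed

text \<open>
  The bounds that define nonoverlapping little disks are convex along a line on which the centers
  are only rescaled, since the distances of the centers are then affine in the parameter.
\<close>

lemma straight_line_in_disk_tuples: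
  fixes W :: "'v::real_inner set"
  assumes W: "subspace W" and d: "d \<in> disk_tuples W n" "d' \<in> disk_tuples W n"
    and k: "k \<ge> 0" "\<And>i. i \<in> {1..n} \<Longrightarrow> snd (d i) = k *\<^sub>R snd (d' i)"
    and t: "t \<in> {0..1}"
  shows "straight_line {1..n} t d d' \<in> disk_tuples W n"
proof -
  define m where "m = (1 - t) * k + t"
  have m: "m \<ge> 0" using t k by (simp add: m_def)
  have D: "fst (d i) > 0" "fst (d' i) > 0" "snd (d' i) \<in> W"
    "fst (d i) + norm (snd (d i)) \<le> 1" "fst (d' i) + norm (snd (d' i)) \<le> 1"
    "W = {0} \<Longrightarrow> fst (d i) = 1" "W = {0} \<Longrightarrow> fst (d' i) = 1" if "i \<in> {1..n}" for i
    using d that unfolding disk_tuples_iff[OF W] by blast+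
  have DD: "fst (d i) + fst (d j) \<le> dist (snd (d i)) (snd (d j))"
    "fst (d' i) + fst (d' j) \<le> dist (snd (d' i)) (snd (d' j))"
    if "i \<in> {1..n}" "j \<in> {1..n}" "i \<noteq> j" for i j
    using d that unfolding disk_tuples_iff[OF W] by blast+
  let ?r = "\<lambda>i. (1 - t) * fst (d i) + t * fst (d' i)"
  have center: "(1 - t) *\<^sub>R snd (d i) + t *\<^sub>R snd (d' i) = m *\<^sub>R snd (d' i)" if "i \<in> {1..n}" for i
    using k that by (simp add: m_def scaleR_add_left)
  have pos: "?r i > 0" if i: "i \<in> {1..n}" for i
  proof (cases "t = 0")
    case False
    then show ?thesis using D[OF i] t by (intro add_nonneg_pos) auto
  qed (use D[OF i] in simp)
  have norm: "?r i + norm (m *\<^sub>R snd (d' i)) \<le> 1" if i: "i \<in> {1..n}" for i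
  proof -
    have "norm (m *\<^sub>R snd (d' i)) = (1 - t) * norm (snd (d i)) + t * norm (snd (d' i))"
      using k(1) k(2)[OF i] m unfolding norm_scaleR by (simp add: m_def algebra_simps)
    then have "?r i + norm (m *\<^sub>R snd (d' i)) =
        (1 - t) * (fst (d i) + norm (snd (d i))) + t * (fst (d' i) + norm (snd (d' i)))"
      by (simp add: algebra_simps)
    also have "\<dots> \<le> (1 - t) * 1 + t * 1"
      using D[OF i] t by (intro add_mono mult_left_mono) auto
    finally show ?thesis by simp
  qed
  have disjoint: "?r i + ?r j \<le> dist (m *\<^sub>R snd (d' i)) (m *\<^sub>R snd (d' j))"
    if i: "i \<in> {1..n}" "j \<in> {1..n}" "i \<noteq> j" for i j
  proof -
    have dist: "dist (a *\<^sub>R x) (a *\<^sub>R y) = a * dist x y" if "a \<ge> 0" for a and x y :: 'v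
      using that by (simp add: dist_norm flip: scaleR_diff_right)
    have "?r i + ?r j = (1 - t) * (fst (d i) + fst (d j)) + t * (fst (d' i) + fst (d' j))"
      by (simp add: algebra_simps)
    also have "\<dots> \<le> (1 - t) * dist (snd (d i)) (snd (d j)) + t * dist (snd (d' i)) (snd (d' j))"
      using DD[OF i] t by (intro add_mono mult_left_mono) auto
    also have "\<dots> = m * dist (snd (d' i)) (snd (d' j))"
      using k(1) k(2)[OF i(1)] k(2)[OF i(2)] by (simp add: dist m_def algebra_simps)
    finally show ?thesis using m by (simp add: dist)
  qed
  have "?r i = 1" if "W = {0}" "i \<in> {1..n}" for i
    using D[OF that(2)] that(1) by simp
  then show ?thesis
    unfolding disk_tuples_iff[OF W] straight_line_def
    using pos norm disjoint center D(3) W by (simp add: subspace_scale)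
qed


section \<open>Ordered finite H-sets and their graph subgroups\<close>

locale ordered_H_set =
  fixes G :: "('g, 'm) monoid_scheme"
    and \<rho> :: "'g \<Rightarrow> 'v::real_inner \<Rightarrow> 'v"
    and H :: "'g set"
    and T :: "'t set"
    and \<tau> :: "'g \<Rightarrow> 't \<Rightarrow> 't"
    and ord :: "nat \<Rightarrow> 't"
  assumes group: "group G"
    and finite_G: "finite (carrier G)"
    and rep: "orthogonal_rep G \<rho>"
    and H: "subgroup H G"
    and finite_T: "finite T"
    and action: "group_action (G\<lparr>carrier := H\<rparr>) T \<tau>"
    and ord: "bij_betw ord {1..card T} T"
begin

abbreviation n :: nat where "n \<equiv> card T"

abbreviation \<phi> :: "'g \<Rightarrow> nat \<Rightarrow> nat" where "\<phi> \<equiv> ordering_hom T \<tau> ord"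

lemma H_carrier: "h \<in> H \<Longrightarrow> h \<in> carrier G"
  using H by (rule subgroup.mem_carrier)

lemma rho_orthogonal: "g \<in> carrier G \<Longrightarrow> orthogonal_transformation (\<rho> g)"
  using rep by (simp add: orthogonal_rep_def)

lemma rho_linear: "g \<in> carrier G \<Longrightarrow> linear (\<rho> g)"
  using rho_orthogonal by (simp add: orthogonal_transformation_def)

lemma rho_norm: "g \<in> carrier G \<Longrightarrow> norm (\<rho> g v) = norm v"
  using rho_orthogonal by (simp add: orthogonal_transformation)

lemma rho_mult:
  assumes "g \<in> carrier G" "g' \<in> carrier G"
  shows "\<rho> (g \<otimes>\<^bsub>G\<^esub> g') v = \<rho> g (\<rho> g' v)"
proof -
  interpret group_action G UNIV \<rho> using rep by (simp add: orthogonal_rep_def)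
  show ?thesis using assms by (simp add: composition_rule)
qed

lemma rho_one: "\<rho> \<one>\<^bsub>G\<^esub> v = v"
proof -
  interpret group_action G UNIV \<rho> using rep by (simp add: orthogonal_rep_def)
  show ?thesis using id_eq_one by (metis UNIV_I restrict_apply)
qed

lemma tau_closed: "h \<in> H \<Longrightarrow> t \<in> T \<Longrightarrow> \<tau> h t \<in> T"
  using group_action.element_image[OF action, of h t] by simp

lemma tau_mult: "h \<in> H \<Longrightarrow> k \<in> H \<Longrightarrow> t \<in> T \<Longrightarrow> \<tau> (h \<otimes>\<^bsub>G\<^esub> k) t = \<tau> h (\<tau> k t)"
  using group_action.composition_rule[OF action, of t h k] by simp

lemma tau_inv: "h \<in> H \<Longrightarrow> t \<in> T \<Longrightarrow> \<tau> (m_inv G h) (\<tau> h t) = t"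
  using group_action.orbit_sym_aux[OF action, of h t] group.m_inv_consistent[OF group H, of h]
  by simp

lemma ord_in: "i \<in> {1..n} \<Longrightarrow> ord i \<in> T"
  using ord by (auto simp: bij_betw_def)

lemma index_in: "t \<in> T \<Longrightarrow> inv_into {1..n} ord t \<in> {1..n}"
  using bij_betw_inv_into[OF ord] by (auto simp: bij_betw_def)

lemma ord_index: "t \<in> T \<Longrightarrow> ord (inv_into {1..n} ord t) = t"
  using ord by (rule bij_betw_inv_into_right)

lemma index_ord: "i \<in> {1..n} \<Longrightarrow> inv_into {1..n} ord (ord i) = i"
  using ord by (rule bij_betw_inv_into_left)

lemma phi_in: "h \<in> H \<Longrightarrow> i \<in> {1..n} \<Longrightarrow> \<phi> h i \<in> {1..n}"
  using index_in[OF tau_closed[OF _ ord_in]] by (simp add: ordering_hom_def)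

lemma ord_phi: "h \<in> H \<Longrightarrow> i \<in> {1..n} \<Longrightarrow> ord (\<phi> h i) = \<tau> h (ord i)"
  using ord_index[OF tau_closed[OF _ ord_in]] by (simp add: ordering_hom_def)

lemma index_tau:
  "h \<in> H \<Longrightarrow> t \<in> T \<Longrightarrow> inv_into {1..n} ord (\<tau> h t) = \<phi> h (inv_into {1..n} ord t)"
  using index_in[of t] ord_index[of t] by (simp add: ordering_hom_def)

lemma phi_permutes:
  assumes "h \<in> H"
  shows "\<phi> h permutes {1..n}"
proof (rule bij_imp_permutes)
  have "bij_betw (\<tau> h) T T"
    using group_action.bij_prop0[OF action, of h] assms by (simp add: Bij_def)
  then have "bij_betw (inv_into {1..n} ord \<circ> (\<tau> h \<circ> ord)) {1..n} {1..n}"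
    using ord bij_betw_inv_into[OF ord] by (blast intro: bij_betw_trans)
  then show "bij_betw (\<phi> h) {1..n} {1..n}"
    by (rule bij_betw_cong[THEN iffD1, rotated]) (simp add: ordering_hom_def)
qed (auto simp: ordering_hom_def)

lemma phi_mult:
  assumes "h \<in> H" "k \<in> H"
  shows "\<phi> (h \<otimes>\<^bsub>G\<^esub> k) = \<phi> h \<circ> \<phi> k"
proof
  fix i
  show "\<phi> (h \<otimes>\<^bsub>G\<^esub> k) i = (\<phi> h \<circ> \<phi> k) i"
  proof (cases "i \<in> {1..n}")
    case True
    have "\<phi> (h \<otimes>\<^bsub>G\<^esub> k) i = inv_into {1..n} ord (\<tau> h (\<tau> k (ord i)))"
      using True tau_mult[OF assms ord_in[OF True]] by (simp add: ordering_hom_def)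
    also have "\<dots> = \<phi> h (\<phi> k i)"
      using True assms by (simp only: index_tau tau_closed ord_in index_ord)
    finally show ?thesis by simp
  next
    case False
    then show ?thesis by (auto simp: ordering_hom_def)
  qed
qed

text \<open>
  The graph is the image of \<open>H\<close> under \<open>h \<mapsto> (h, \<phi> h)\<close>, which is a homomorphism by \<open>phi_mult\<close>.
\<close>

lemma subgroup_graph: "subgroup (graph_subgroup H T \<tau> ord) (G \<times>\<times> sym_group n)"
proof -
  have "group_hom (G\<lparr>carrier := H\<rparr>) (G \<times>\<times> sym_group n) (\<lambda>h. (h, \<phi> h))"
  proof (intro group_hom.intro group_hom_axioms.intro)
    show "group (G\<lparr>carrier := H\<rparr>)" using H group by (rule subgroup.subgroup_is_group)
    show "group (G \<times>\<times> sym_group n)" using group sym_group_is_group by (rule DirProd_group)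
    show "(\<lambda>h. (h, \<phi> h)) \<in> hom (G\<lparr>carrier := H\<rparr>) (G \<times>\<times> sym_group n)"
      by (auto simp: hom_def sym_group_carrier sym_group_mult phi_mult H_carrier simp del: One_nat_def intro: phi_permutes)
  qed
  then have "subgroup ((\<lambda>h. (h, \<phi> h)) ` H) (G \<times>\<times> sym_group n)"
    using group_hom.img_is_subgroup by fastforce
  moreover have "(\<lambda>h. (h, \<phi> h)) ` H = graph_subgroup H T \<tau> ord"
    by (auto simp: graph_subgroup_def)
  ultimately show ?thesis by simp
qed


section \<open>Fixed tuples of disks\<close>

definition fixed_tuples :: "'v set \<Rightarrow> (nat \<Rightarrow> 'v disk) set" where
  "fixed_tuples W =
     {d \<in> disk_tuples W n. \<forall>h\<in>H. \<forall>i\<in>{1..n}. d (\<phi> h i) = disk_conj \<rho> h (d i)}"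

text \<open>
  Substituting \<open>\<phi> h i\<close> for the index removes the inverse permutation from the action on tuples.
\<close>

lemma fixed_iff:
  assumes "d \<in> extensional {1..n}"
  shows "(\<forall>k\<in>graph_subgroup H T \<tau> ord. tuple_act (disk_conj \<rho>) n k d = d) \<longleftrightarrow>
    (\<forall>h\<in>H. \<forall>i\<in>{1..n}. d (\<phi> h i) = disk_conj \<rho> h (d i))"
proof -
  have "tuple_act (disk_conj \<rho>) n (h, \<phi> h) d = d \<longleftrightarrow>
      (\<forall>i\<in>{1..n}. d (\<phi> h i) = disk_conj \<rho> h (d i))" (is "?L \<longleftrightarrow> ?R") if h: "h \<in> H" for h
  proof
    assume L: ?L
    show ?R
    proof
      fix i assume i: "i \<in> {1..n}"
      have "d (\<phi> h i) = tuple_act (disk_conj \<rho>) n (h, \<phi> h) d (\<phi> h i)" using L by simp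
      also have "\<dots> = disk_conj \<rho> h (d (inv_into UNIV (\<phi> h) (\<phi> h i)))"
        using phi_in[OF h i] by (simp add: tuple_act_def)
      also have "inv_into UNIV (\<phi> h) (\<phi> h i) = i"
        using permutes_inverses(2)[OF phi_permutes[OF h]] .
      finally show "d (\<phi> h i) = disk_conj \<rho> h (d i)" .
    qed
  next
    assume R: ?R
    show ?L
    proof
      fix i
      show "tuple_act (disk_conj \<rho>) n (h, \<phi> h) d i = d i"
      proof (cases "i \<in> {1..n}")
        case True
        let ?j = "inv_into UNIV (\<phi> h) i"
        have "?j \<in> {1..n}"
          using True permutes_in_image[OF permutes_inv[OF phi_permutes[OF h]]] by blast
        then have "disk_conj \<rho> h (d ?j) = d (\<phi> h ?j)" using R by simp
        also have "\<phi> h ?j = i" using permutes_inverses(1)[OF phi_permutes[OF h]] .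
        finally show ?thesis using True by (simp add: tuple_act_def)
      next
        case False
        then show ?thesis using assms by (auto simp: tuple_act_def extensional_def)
      qed
    qed
  qed
  then show ?thesis by (auto simp: graph_subgroup_def)
qed

lemma disk_tuples_extensional: "disk_tuples W m \<subseteq> extensional {1..m}"
  by (auto simp: disk_tuples_def PiE_def)

lemma tendsto_rho:
  assumes "g \<in> carrier G" "(f \<longlongrightarrow> l) F"
  shows "((\<lambda>x. \<rho> g (f x)) \<longlongrightarrow> \<rho> g l) F"
proof (rule tendstoI)
  fix e :: real assume "e > 0"
  have "dist (\<rho> g x) (\<rho> g y) = dist x y" for x y
    using assms(1) by (simp add: dist_norm rho_norm flip: linear_diff[OF rho_linear])
  then show "\<forall>\<^sub>F x in F. dist (\<rho> g (f x)) (\<rho> g l) < e"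
    using tendstoD[OF assms(2) \<open>e > 0\<close>] by simp
qed

text \<open>
  Taking fixed points commutes with the union because being fixed is a closed condition.
\<close>

lemma disk_fixed_space_eq:
  "disk_fixed_space G \<rho> n (graph_subgroup H T \<tau> ord) =
     filtered_tuples (fd_subreps G \<rho>) {1..n} fixed_tuples"
proof -
  let ?Fix = "{d. \<forall>k\<in>graph_subgroup H T \<tau> ord. tuple_act (disk_conj \<rho>) n k d = d}"
  let ?P = "product_topology (\<lambda>_::nat. euclidean :: 'v disk topology) {1..n}"
  have fixed: "disk_tuples W n \<inter> ?Fix = fixed_tuples W" for W
  proof -
    have "d \<in> ?Fix \<longleftrightarrow> (\<forall>h\<in>H. \<forall>i\<in>{1..n}. d (\<phi> h i) = disk_conj \<rho> h (d i))"
      if "d \<in> disk_tuples W n" for d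
      unfolding mem_Collect_eq using that disk_tuples_extensional by (intro fixed_iff) blast
    then show ?thesis unfolding fixed_tuples_def by blast
  qed
  have top: "topspace (disk_space_in W n) = disk_tuples W n" for W
    using disk_tuples_extensional[of W n] by (auto simp: disk_space_in_def PiE_def)
  have "closedin (disk_space_in W n) (topspace (disk_space_in W n) \<inter> ?Fix)" for W
  proof -
    define E where "E = (\<lambda>(h, i). {d \<in> topspace (disk_space_in W n). d (\<phi> h i) = disk_conj \<rho> h (d i)})"
    have "closedin (disk_space_in W n) (E (h, i))" if h: "h \<in> H" and i: "i \<in> {1..n}" for h i
    proof -
      have proj: "continuous_map (disk_space_in W n) euclidean (\<lambda>d. d j)" if "j \<in> {1..n}" for j
        unfolding disk_space_in_def using that by (intro continuous_intros)
      have "continuous_map (disk_space_in W n) euclidean (\<lambda>d. disk_conj \<rho> h (d i))"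
        using proj[OF i] unfolding continuous_map_euclidean_iff_tendsto disk_conj_def
        by (auto intro!: tendsto_intros tendsto_rho[OF H_carrier[OF h]])
      with closedin_continuous_maps_eq[OF Hausdorff_space_euclidean proj[OF phi_in[OF h i]]]
      show ?thesis unfolding E_def by simp
    qed
    then have "closedin (disk_space_in W n)
        (\<Inter> (insert (topspace (disk_space_in W n)) (E ` (H \<times> {1..n}))))"
      by (intro closedin_Inter) auto
    also have "\<Inter> (insert (topspace (disk_space_in W n)) (E ` (H \<times> {1..n}))) = fixed_tuples W"
      unfolding E_def fixed_tuples_def top by auto
    finally show ?thesis by (simp add: top fixed)
  qed
  then have "disk_fixed_space G \<rho> n (graph_subgroup H T \<tau> ord) =
      union_topology (fd_subreps G \<rho>) (\<lambda>W. subtopology (disk_space_in W n) ?Fix)"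
    unfolding disk_fixed_space_def disk_space_def by (rule subtopology_union_topology)
  also have "(\<lambda>W. subtopology (disk_space_in W n) ?Fix) = (\<lambda>W. subtopology ?P (fixed_tuples W))"
    by (simp add: disk_space_in_def subtopology_subtopology fixed)
  finally show ?thesis by (simp add: filtered_tuples_def)
qed

lemma embedding_space_eq:
  "embedding_space G \<rho> H T \<tau> = filtered_tuples (fd_subreps G \<rho>) T (embeddings_in H \<rho> T \<tau>)"
  by (simp add: embedding_space_def filtered_tuples_def)

lemma fd_subrep_subspace: "W \<in> fd_subreps G \<rho> \<Longrightarrow> subspace W"
  by (simp add: fd_subreps_def)

text \<open>
  On the zero subrepresentation all little disks have radius \<open>1\<close>, so disks can be shrunk only
  after passing to a nonzero subrepresentation, such as the span of an orbit, which is finite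
  dimensional as \<open>G\<close> is finite.
\<close>

lemma larger_subrep:
  assumes "W \<in> fd_subreps G \<rho>"
  obtains W' where "W' \<in> fd_subreps G \<rho>" "W \<subseteq> W'" "W' = {0} \<longrightarrow> (UNIV :: 'v set) = {0}"
proof (cases "W = {0} \<and> (UNIV :: 'v set) \<noteq> {0}")
  case True
  then obtain v :: 'v where v: "v \<noteq> 0" by auto
  let ?O = "(\<lambda>g. \<rho> g v) ` carrier G"
  interpret G: group G by (rule group)
  have "\<rho> g ` span ?O \<subseteq> span ?O" if g: "g \<in> carrier G" for g
  proof -
    have "\<rho> g ` ?O \<subseteq> ?O"
      using g by (auto simp flip: rho_mult)
    then have "span (\<rho> g ` ?O) \<subseteq> span ?O" by (rule span_mono)
    then show ?thesis by (simp add: linear_span_image[OF rho_linear[OF g]])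
  qed
  then have "span ?O \<in> fd_subreps G \<rho>"
    using finite_G by (auto simp: fd_subreps_def)
  moreover have "v \<in> span ?O"
    using rho_one G.one_closed by (metis image_eqI span_base)
  ultimately show ?thesis using True v that[of "span ?O"] span_zero by blast
next
  case False
  then show ?thesis using assms that[of W] by blast
qed

section \<open>Centers and the sections of disks around embeddings\<close>

lemma fixed_tuples_mono:
  assumes "W \<in> fd_subreps G \<rho>" "W' \<in> fd_subreps G \<rho>" "W \<subseteq> W'"
  shows "fixed_tuples W \<subseteq> fixed_tuples W'"
  using disk_tuples_mono[OF fd_subrep_subspace[OF assms(1)] fd_subrep_subspace[OF assms(2)] assms(3)]
  by (auto simp: fixed_tuples_def)

lemma embeddings_in_mono: "W \<subseteq> W' \<Longrightarrow> embeddings_in H \<rho> T \<tau> W \<subseteq> embeddings_in H \<rho> T \<tau> W'"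
  by (auto simp: embeddings_in_def PiE_def)

lemma centers_ord: "i \<in> {1..n} \<Longrightarrow> centers T ord d (ord i) = snd (d i)"
  using ord_in index_ord by (simp add: centers_def)

lemma centers_in_embeddings:
  assumes W: "W \<in> fd_subreps G \<rho>" and d: "d \<in> fixed_tuples W"
  shows "centers T ord d \<in> embeddings_in H \<rho> T \<tau> W"
proof -
  let ?i = "inv_into {1..n} ord"
  have D: "d \<in> disk_tuples W n" and
    eq: "\<And>h i. h \<in> H \<Longrightarrow> i \<in> {1..n} \<Longrightarrow> d (\<phi> h i) = disk_conj \<rho> h (d i)"
    using d by (auto simp: fixed_tuples_def)
  note D = D[unfolded disk_tuples_iff[OF fd_subrep_subspace[OF W]]]
  have "centers T ord d \<in> T \<rightarrow>\<^sub>E W"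
    using D index_in by (auto simp: centers_def)
  moreover have "inj_on (centers T ord d) T"
  proof (rule inj_onI, rule ccontr)
    fix t u assume tu: "t \<in> T" "u \<in> T" "centers T ord d t = centers T ord d u" "t \<noteq> u"
    then have "?i t \<noteq> ?i u" using ord_index by metis
    then have "fst (d (?i t)) + fst (d (?i u)) \<le> dist (snd (d (?i t))) (snd (d (?i u)))"
      using D index_in[OF tu(1)] index_in[OF tu(2)] by blast
    moreover have "fst (d (?i t)) > 0" "fst (d (?i u)) > 0"
      using D index_in[OF tu(1)] index_in[OF tu(2)] by blast+
    ultimately show False using tu by (simp add: centers_def)
  qed
  moreover have "centers T ord d (\<tau> h t) = \<rho> h (centers T ord d t)" if "h \<in> H" "t \<in> T" for h t
    using that eq[OF that(1) index_in[OF that(2)]]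
    by (simp add: centers_def tau_closed index_tau disk_conj_def del: One_nat_def)
  ultimately show ?thesis by (simp add: embeddings_in_def)
qed

text \<open>
  Invariance makes a tuple with these radii around an equivariant embedding a fixed tuple.  The
  radius \<open>1\<close> is forced on the zero representation, where it is the only representative of the one
  affine map.
\<close>

definition invariant_radii :: "(nat \<Rightarrow> real) \<Rightarrow> bool" where
  "invariant_radii r \<longleftrightarrow> (\<forall>i\<in>{1..n}. r i > 0 \<and> ((UNIV :: 'v set) = {0} \<longrightarrow> r i = 1) \<and>
     (\<forall>h\<in>H. r (\<phi> h i) = r i))"

definition disks_around :: "(nat \<Rightarrow> real) \<Rightarrow> ('t \<Rightarrow> 'v) \<Rightarrow> (nat \<Rightarrow> 'v disk)" where
  "disks_around r e = fitted_disks {1..n} r (\<lambda>i. e (ord i))"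

text \<open>
  The factors in \<open>fitted_disks\<close> are common to all entries of the tuple, so they preserve the
  invariance of the radii and, by linearity of the action, the equivariance of the centers.
\<close>

lemma disks_around_in_fixed_tuples:
  assumes W: "W \<in> fd_subreps G \<rho>" "W = {0} \<longrightarrow> (UNIV :: 'v set) = {0}"
    and r: "invariant_radii r" and e: "e \<in> embeddings_in H \<rho> T \<tau> W"
  shows "disks_around r e \<in> fixed_tuples W"
proof -
  have eW: "e t \<in> W" and eq: "h \<in> H \<Longrightarrow> e (\<tau> h t) = \<rho> h (e t)" if "t \<in> T" for t h
    using e that by (auto simp: embeddings_in_def)
  have "inj_on e T" using e by (simp add: embeddings_in_def)
  then have "inj_on (e \<circ> ord) {1..n}"
    using ord by (intro comp_inj_on) (auto simp: bij_betw_def)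
  then have inj: "inj_on (\<lambda>i. e (ord i)) {1..n}" by (simp add: o_def)
  have "disks_around r e \<in> disk_tuples W n"
    unfolding disks_around_def
  proof (rule fitted_disks_in_disk_tuples[OF fd_subrep_subspace[OF W(1)] _ _ _ _ inj])
    show "r i > 0" "(UNIV :: 'v set) = {0} \<Longrightarrow> r i = 1" if "i \<in> {1..n}" for i
      using r that unfolding invariant_radii_def by blast+
    show "e (ord i) \<in> W" if "i \<in> {1..n}" for i using eW ord_in[OF that] by blast
    show "(UNIV :: 'v set) = {0}" if "W = {0}" using W(2) that by (rule mp)
  qed
  moreover have "disks_around r e (\<phi> h i) = disk_conj \<rho> h (disks_around r e i)"
    if h: "h \<in> H" and i: "i \<in> {1..n}" for h i
  proof -
    have "r (\<phi> h i) = r i" using r h i by (simp add: invariant_radii_def)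
    then show ?thesis
      using phi_in[OF h i] i
      by (simp add: disks_around_def fitted_disks_def disk_conj_def ord_phi[OF h i]
          eq[OF ord_in[OF i] h] linear_scale[OF rho_linear[OF H_carrier[OF h]]])
  qed
  ultimately show ?thesis by (simp add: fixed_tuples_def)
qed

lemma centers_disks_around:
  assumes "t \<in> T"
  shows "centers T ord (disks_around r e) t = (1 / overflow {1..n} r (\<lambda>i. e (ord i))) *\<^sub>R e t"
  using assms index_in[OF assms] by (simp add: centers_def disks_around_def fitted_disks_def ord_index del: One_nat_def)

lemma radii_invariant:
  assumes W: "W \<in> fd_subreps G \<rho>" and d: "d \<in> fixed_tuples W"
  shows "invariant_radii (\<lambda>i. fst (d i))"
proof -
  have "fst (d i) = 1" if "(UNIV :: 'v set) = {0}" "i \<in> {1..n}" for i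
  proof -
    have "W = {0}" using that(1) fd_subrep_subspace[OF W] subspace_0 by blast
    then show ?thesis
      using d that disk_tuples_iff[OF fd_subrep_subspace[OF W], of d n]
      unfolding fixed_tuples_def by blast
  qed
  then show ?thesis
    using d by (auto simp: invariant_radii_def fixed_tuples_def disk_conj_def
        disk_tuples_iff[OF fd_subrep_subspace[OF W]])
qed

text \<open>
  Disks that are already admissible are left alone, so with the radii of \<open>d\<close> the section goes
  through the point \<open>d\<close>.
\<close>

lemma disks_around_centers:
  assumes W: "W \<in> fd_subreps G \<rho>" and d: "d \<in> fixed_tuples W"
  shows "disks_around (\<lambda>i. fst (d i)) (centers T ord d) = d"
proof -
  have "d \<in> disk_tuples W n" using d by (simp add: fixed_tuples_def)
  note D = this[unfolded disk_tuples_iff[OF fd_subrep_subspace[OF W]]]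
  have "disks_around (\<lambda>i. fst (d i)) (centers T ord d) =
      fitted_disks {1..n} (\<lambda>i. fst (d i)) (\<lambda>i. snd (d i))"
    unfolding disks_around_def by (rule fitted_disks_cong) (rule centers_ord)
  also have "\<dots> = d" by (rule fitted_disks_unchanged) (use D in blast)+
  finally show ?thesis .
qed

lemma continuous_map_centers:
  "continuous_map (subtopology (product_topology (\<lambda>_. euclidean) {1..n}) S)
     (product_topology (\<lambda>_. euclidean) T) (centers T ord)"
  unfolding continuous_map_componentwise
proof (intro conjI ballI)
  let ?X = "subtopology (product_topology (\<lambda>_. euclidean) {1..n}) S"
  fix t assume t: "t \<in> T"
  have "continuous_map ?X euclidean (\<lambda>d. d (inv_into {1..n} ord t))"
    using index_in[OF t] by (intro continuous_intros)
  then have "continuous_map ?X euclidean (\<lambda>d. snd (d (inv_into {1..n} ord t)))"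
    unfolding continuous_map_euclidean_iff_tendsto by (auto intro: tendsto_snd)
  then show "continuous_map ?X euclidean (\<lambda>d. centers T ord d t)"
    using t by (simp add: centers_def)
qed (auto simp: centers_def)

text \<open>
  The crowding divides by distances of points; these do not vanish because embeddings are injective.
\<close>

lemma continuous_map_disks_around:
  "continuous_map (subtopology (product_topology (\<lambda>_. euclidean) T) (embeddings_in H \<rho> T \<tau> W))
     (product_topology (\<lambda>_. euclidean) {1..n}) (disks_around r)"
  unfolding continuous_map_componentwise
proof (intro conjI ballI)
  let ?X = "subtopology (product_topology (\<lambda>_. euclidean) T) (embeddings_in H \<rho> T \<tau> W)"
  fix i assume i: "i \<in> {1..n}"
  let ?A = "\<lambda>e. overflow {1..n} r (\<lambda>i. e (ord i))" and ?B = "\<lambda>e. crowding {1..n} r (\<lambda>i. e (ord i))"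
  have "((\<lambda>e. (r i / (?A e * ?B e), (1 / ?A e) *\<^sub>R e (ord i))) \<longlongrightarrow>
      (r i / (?A e * ?B e), (1 / ?A e) *\<^sub>R e (ord i))) (atin ?X e)"
    if e: "e \<in> topspace ?X" for e
  proof -
    have lim: "((\<lambda>e. e (ord j)) \<longlongrightarrow> e (ord j)) (atin ?X e)" if "j \<in> {1..n}" for j
    proof -
      have "continuous_map ?X euclidean (\<lambda>e. e (ord j))"
        using ord_in[OF that] by (intro continuous_intros)
      then show ?thesis using e unfolding continuous_map_euclidean_iff_tendsto by blast
    qed
    have inj: "e (ord j) \<noteq> e (ord l)" if "j \<in> {1..n}" "l \<in> {1..n} - {j}" for j l
    proof -
      have "inj_on e T" using e by (simp add: embeddings_in_def)
      moreover have "ord j \<noteq> ord l" using that bij_betw_imp_inj_on[OF ord] by (auto dest: inj_onD)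
      ultimately show ?thesis using ord_in that by (auto dest: inj_onD)
    qed
    have A: "(?A \<longlongrightarrow> ?A e) (atin ?X e)"
      unfolding overflow_def by (intro tendsto_intros lim) auto
    have B: "(?B \<longlongrightarrow> ?B e) (atin ?X e)"
      unfolding crowding_def using inj by (intro tendsto_intros lim) auto
    have "?A e \<noteq> 0" "?B e \<noteq> 0"
      using overflow_ge_1[of "{1..n}" r "\<lambda>i. e (ord i)"] crowding_ge_1[of "{1..n}" r "\<lambda>i. e (ord i)"]
      by auto
    then show ?thesis by (intro tendsto_intros A B lim[OF i]) auto
  qed
  then show "continuous_map ?X euclidean (\<lambda>e. disks_around r e i)"
    using i unfolding continuous_map_euclidean_iff_tendsto
    by (simp add: disks_around_def fitted_disks_def)
qed (auto simp: disks_around_def fitted_disks_def)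

lemma continuous_map_centers_fixed:
  "continuous_map (filtered_tuples (fd_subreps G \<rho>) {1..n} fixed_tuples)
     (filtered_tuples (fd_subreps G \<rho>) T (embeddings_in H \<rho> T \<tau>)) (centers T ord)"
proof (rule continuous_map_filtered_tuples)
  show "\<exists>W'\<in>fd_subreps G \<rho>. centers T ord \<in> fixed_tuples W \<rightarrow> embeddings_in H \<rho> T \<tau> W'"
    if "W \<in> fd_subreps G \<rho>" for W
    using that centers_in_embeddings by blast
qed (rule continuous_map_centers)

lemma continuous_map_disks_around_embeddings:
  assumes "invariant_radii r"
  shows "continuous_map (filtered_tuples (fd_subreps G \<rho>) T (embeddings_in H \<rho> T \<tau>))
     (filtered_tuples (fd_subreps G \<rho>) {1..n} fixed_tuples) (disks_around r)"
proof (rule continuous_map_filtered_tuples)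
  fix W assume "W \<in> fd_subreps G \<rho>"
  then obtain W' where "W' \<in> fd_subreps G \<rho>" "W \<subseteq> W'" "W' = {0} \<longrightarrow> (UNIV :: 'v set) = {0}"
    by (rule larger_subrep)
  then show "\<exists>W'\<in>fd_subreps G \<rho>. disks_around r \<in> embeddings_in H \<rho> T \<tau> W \<rightarrow> fixed_tuples W'"
    using disks_around_in_fixed_tuples[OF _ _ assms] embeddings_in_mono by blast
qed (rule continuous_map_disks_around)


section \<open>The center map is a weak equivalence\<close>

lemma embeddings_in_extensional: "embeddings_in H \<rho> T \<tau> W \<subseteq> extensional T"
  by (auto simp: embeddings_in_def PiE_def)

lemma fixed_tuples_extensional: "fixed_tuples W \<subseteq> extensional {1..n}"
  using disk_tuples_extensional by (auto simp: fixed_tuples_def)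

lemma rescaled_embedding:
  assumes W: "W \<in> fd_subreps G \<rho>" and e: "e \<in> embeddings_in H \<rho> T \<tau> W" and k: "k \<noteq> 0"
  shows "(\<lambda>t\<in>T. k *\<^sub>R e t) \<in> embeddings_in H \<rho> T \<tau> W"
proof -
  have "k *\<^sub>R e t \<in> W" if "t \<in> T" for t
    using e that fd_subrep_subspace[OF W] by (auto simp: embeddings_in_def intro: subspace_scale)
  then show ?thesis
    using e k tau_closed
    by (auto simp: embeddings_in_def inj_on_def linear_scale[OF rho_linear[OF H_carrier]])
qed

text \<open>
  The composite rescales each embedding by a positive number, and positive multiples of an
  equivariant embedding remain equivariant and injective.
\<close>

lemma homotopy_on_embeddings:
  fixes r
  defines "E \<equiv> filtered_tuples (fd_subreps G \<rho>) T (embeddings_in H \<rho> T \<tau>)"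
    and "g \<equiv> centers T ord \<circ> disks_around r"
  shows "homotopic_with (\<lambda>k. \<forall>e\<in>topspace E. g e = e \<longrightarrow> k e = e) E E g id"
  unfolding E_def g_def
proof (rule straight_line_homotopy[OF embeddings_in_extensional])
  show "continuous_map (subtopology (product_topology (\<lambda>_. euclidean) T) (embeddings_in H \<rho> T \<tau> W))
      (product_topology (\<lambda>_. euclidean) T) (centers T ord \<circ> disks_around r)" for W
    using continuous_map_compose[OF continuous_map_disks_around
        continuous_map_centers[of UNIV, unfolded subtopology_UNIV]] .
  show "\<exists>W'\<in>fd_subreps G \<rho>. \<forall>e\<in>embeddings_in H \<rho> T \<tau> W. \<forall>t\<in>{0..1}.
      straight_line T t ((centers T ord \<circ> disks_around r) e) e \<in> embeddings_in H \<rho> T \<tau> W'"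
    if W: "W \<in> fd_subreps G \<rho>" for W
  proof (intro bexI[OF _ W] ballI)
    fix e and s :: real assume e: "e \<in> embeddings_in H \<rho> T \<tau> W" and s: "s \<in> {0..1}"
    define k where "k = 1 / overflow {1..n} r (\<lambda>i. e (ord i))"
    have "k > 0" using overflow_ge_1[of "{1..n}" r "\<lambda>i. e (ord i)"] by (simp add: k_def)
    then have "(1 - s) * k + s \<noteq> 0"
      using s by (cases "s = 0") (auto simp: add_nonneg_pos less_imp_neq[THEN not_sym])
    then have "(\<lambda>t\<in>T. ((1 - s) * k + s) *\<^sub>R e t) \<in> embeddings_in H \<rho> T \<tau> W"
      by (rule rescaled_embedding[OF W e])
    also have "(\<lambda>t\<in>T. ((1 - s) * k + s) *\<^sub>R e t) =
        straight_line T s ((centers T ord \<circ> disks_around r) e) e"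
      unfolding straight_line_def
      by (rule restrict_ext) (simp add: centers_disks_around k_def scaleR_add_left)
    finally show "straight_line T s ((centers T ord \<circ> disks_around r) e) e
        \<in> embeddings_in H \<rho> T \<tau> W" .
  qed
qed

text \<open>
  Along the line the radii move between two admissible families while the centers are rescaled,
  so \<open>straight_line_in_disk_tuples\<close> applies; fixedness is linear and passes to the line.
\<close>

lemma homotopy_on_fixed_tuples:
  assumes r: "invariant_radii r"
  defines "F \<equiv> filtered_tuples (fd_subreps G \<rho>) {1..n} fixed_tuples"
    and "g \<equiv> disks_around r \<circ> centers T ord"
  shows "homotopic_with (\<lambda>k. \<forall>d\<in>topspace F. g d = d \<longrightarrow> k d = d) F F g id"
  unfolding F_def g_def
proof (rule straight_line_homotopy[OF fixed_tuples_extensional])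
  show "continuous_map (subtopology (product_topology (\<lambda>_. euclidean) {1..n}) (fixed_tuples W))
      (product_topology (\<lambda>_. euclidean) {1..n}) (disks_around r \<circ> centers T ord)"
    if W: "W \<in> fd_subreps G \<rho>" for W
  proof (rule continuous_map_compose[OF _ continuous_map_disks_around])
    show "continuous_map (subtopology (product_topology (\<lambda>_. euclidean) {1..n}) (fixed_tuples W))
       (subtopology (product_topology (\<lambda>_. euclidean) T) (embeddings_in H \<rho> T \<tau> W)) (centers T ord)"
      using continuous_map_centers centers_in_embeddings[OF W]
      by (auto simp: continuous_map_in_subtopology)
  qed
  show "\<exists>W'\<in>fd_subreps G \<rho>. \<forall>d\<in>fixed_tuples W. \<forall>s\<in>{0..1}.
      straight_line {1..n} s ((disks_around r \<circ> centers T ord) d) d \<in> fixed_tuples W'"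
    if W: "W \<in> fd_subreps G \<rho>" for W
  proof -
    obtain W' where W': "W' \<in> fd_subreps G \<rho>" "W \<subseteq> W'" "W' = {0} \<longrightarrow> (UNIV :: 'v set) = {0}"
      using larger_subrep[OF W] .
    have "straight_line {1..n} s (disks_around r (centers T ord d)) d \<in> fixed_tuples W'"
      if "d \<in> fixed_tuples W" and s: "s \<in> {0..1}" for d s
    proof -
      let ?d = "disks_around r (centers T ord d)"
      have d: "d \<in> fixed_tuples W'" using that fixed_tuples_mono[OF W W'(1,2)] by blast
      then have d': "?d \<in> fixed_tuples W'"
        using centers_in_embeddings disks_around_in_fixed_tuples W' r by blast
      define k where "k = 1 / overflow {1..n} r (\<lambda>i. centers T ord d (ord i))"
      have "straight_line {1..n} s ?d d \<in> disk_tuples W' n"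
      proof (rule straight_line_in_disk_tuples)
        show "subspace W'" using W'(1) by (rule fd_subrep_subspace)
        show "k \<ge> 0"
          using overflow_ge_1[of "{1..n}" r "\<lambda>i. centers T ord d (ord i)"] by (simp add: k_def)
        show "snd (?d i) = k *\<^sub>R snd (d i)" if "i \<in> {1..n}" for i
          using that by (simp add: disks_around_def fitted_disks_def k_def centers_ord)
      qed (use d d' s in \<open>auto simp: fixed_tuples_def\<close>)
      moreover have "straight_line {1..n} s ?d d (\<phi> h i) =
          disk_conj \<rho> h (straight_line {1..n} s ?d d i)" if h: "h \<in> H" and i: "i \<in> {1..n}" for h i
      proof -
        have "d (\<phi> h i) = disk_conj \<rho> h (d i)" "?d (\<phi> h i) = disk_conj \<rho> h (?d i)"
          using d d' h i by (auto simp: fixed_tuples_def)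
        then show ?thesis
          using i phi_in[OF h i] rho_linear[OF H_carrier[OF h]]
          by (simp add: straight_line_def disk_conj_def linear_add linear_scale)
      qed
      ultimately show ?thesis by (simp add: fixed_tuples_def)
    qed
    then show ?thesis using W'(1) by (intro bexI[of _ W']) auto
  qed
qed

text \<open>
  The section through \<open>d\<close> provides a pointed homotopy inverse at \<open>d\<close>.  For surjectivity on path
  components there is no tuple to start from, and the section with all radii \<open>1\<close> serves instead.
\<close>

lemma weak_equivalence_centers:
  "weak_equivalence (disk_fixed_space G \<rho> n (graph_subgroup H T \<tau> ord))
     (embedding_space G \<rho> H T \<tau>) (centers T ord)"
  unfolding disk_fixed_space_eq embedding_space_eq
proof (rule weak_equivalence_if_pointed_inverses)
  let ?F = "filtered_tuples (fd_subreps G \<rho>) {1..n} fixed_tuples"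
  let ?E = "filtered_tuples (fd_subreps G \<rho>) T (embeddings_in H \<rho> T \<tau>)"
  note top_F = topspace_filtered_tuples[of "fd_subreps G \<rho>" fixed_tuples, OF fixed_tuples_extensional]
  note top_E = topspace_filtered_tuples[of "fd_subreps G \<rho>" "embeddings_in H \<rho> T \<tau>",
      OF embeddings_in_extensional]
  show "continuous_map ?F ?E (centers T ord)" by (rule continuous_map_centers_fixed)
  show "\<exists>g. continuous_map ?E ?F g \<and> g (centers T ord d) = d \<and>
      homotopic_with (\<lambda>k. k d = d) ?F ?F (g \<circ> centers T ord) id \<and>
      homotopic_with (\<lambda>k. k (centers T ord d) = centers T ord d) ?E ?E (centers T ord \<circ> g) id"
    if dF: "d \<in> topspace ?F" for d
  proof -
    obtain W where W: "W \<in> fd_subreps G \<rho>" and d: "d \<in> fixed_tuples W"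
      using dF unfolding top_F by blast
    let ?r = "\<lambda>i. fst (d i)"
    have r: "invariant_radii ?r" by (rule radii_invariant[OF W d])
    have eq: "disks_around ?r (centers T ord d) = d" by (rule disks_around_centers[OF W d])
    have "centers T ord d \<in> topspace ?E"
      using centers_in_embeddings[OF W d] W unfolding top_E by blast
    then have "homotopic_with (\<lambda>k. k (centers T ord d) = centers T ord d) ?E ?E
        (centers T ord \<circ> disks_around ?r) id"
      by (intro homotopic_with_mono[OF homotopy_on_embeddings]) (simp add: eq)
    moreover have "homotopic_with (\<lambda>k. k d = d) ?F ?F (disks_around ?r \<circ> centers T ord) id"
      by (intro homotopic_with_mono[OF homotopy_on_fixed_tuples[OF r]]) (use dF eq in auto)
    ultimately show ?thesis
      using continuous_map_disks_around_embeddings[OF r] eq by blast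
  qed
  show "\<exists>d\<in>topspace ?F. path_component_of ?E (centers T ord d) e" if e: "e \<in> topspace ?E" for e
  proof -
    have r: "invariant_radii (\<lambda>_. 1)" by (simp add: invariant_radii_def)
    let ?g = "disks_around (\<lambda>_. 1)"
    have "?g e \<in> topspace ?F"
      using continuous_map_funspace[OF continuous_map_disks_around_embeddings[OF r]] e by blast
    moreover have "path_component_of ?E (centers T ord (?g e)) e"
      using homotopic_with_path_component_of[OF homotopy_on_embeddings e] by simp
    ultimately show ?thesis by blast
  qed
qed


section \<open>Equivariant multiplications\<close>

text \<open>
  Fixedness of \<open>d\<close> turns the equivariance of \<open>\<theta>\<close> under \<open>(h, \<phi> h)\<close> into that of \<open>\<theta> n d\<close>, because the
  ordering carries the conjugation action on maps to the action of \<open>(h, \<phi> h)\<close> on tuples.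
\<close>

lemma equivariant_multiplication:
  fixes X :: "'x topology"
  assumes X: "disks_algebra G \<rho> X \<alpha> \<theta>"
    and d: "d \<in> topspace (disk_fixed_space G \<rho> n (graph_subgroup H T \<tau> ord))"
  shows "equivariant_map_to G H T \<tau> X \<alpha> (multiplication \<theta> T ord d)"
  unfolding equivariant_map_to_def
proof (intro conjI ballI)
  let ?D = "disk_space G \<rho> n" and ?X = "product_topology (\<lambda>_. X) {1..n}"
  have dD: "d \<in> topspace ?D" and
    fixed: "\<And>k. k \<in> graph_subgroup H T \<tau> ord \<Longrightarrow> tuple_act (disk_conj \<rho>) n k d = d"
    using d by (auto simp: disk_fixed_space_def)
  define u where "u = (\<lambda>f :: 't \<Rightarrow> 'x. \<lambda>i\<in>{1..n}. f (ord i))"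
  have mult: "multiplication \<theta> T ord d f = \<theta> n d (u f)" for f
    by (simp add: multiplication_def u_def)
  have cont_u: "continuous_map (map_space T X) ?X u"
    unfolding continuous_map_componentwise
  proof (intro conjI ballI)
    fix i assume i: "i \<in> {1..n}"
    have "continuous_map (map_space T X) X (\<lambda>f. f (ord i))"
      unfolding map_space_def using ord_in[OF i] by (rule continuous_map_product_projection)
    then show "continuous_map (map_space T X) X (\<lambda>f. u f i)" using i by (simp add: u_def)
  qed (auto simp: u_def)
  have "continuous_map (prod_topology ?D ?X) X (\<lambda>(d, x). \<theta> n d x)"
    using X by (simp add: disks_algebra_def)
  moreover have "continuous_map (map_space T X) (prod_topology ?D ?X) (\<lambda>f. (d, u f))"
    using cont_u dD by (auto simp: continuous_map_pairwise o_def)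
  ultimately have "continuous_map (map_space T X) X ((\<lambda>(d, x). \<theta> n d x) \<circ> (\<lambda>f. (d, u f)))"
    by (rule continuous_map_compose[rotated])
  moreover have "(\<lambda>(d, x). \<theta> n d x) \<circ> (\<lambda>f. (d, u f)) = multiplication \<theta> T ord d"
    by (rule ext) (simp add: mult)
  ultimately show "continuous_map (map_space T X) X (multiplication \<theta> T ord d)" by metis
  fix h f assume h: "h \<in> H" and f: "f \<in> topspace (map_space T X)"
  have u_conj: "u (map_conj G T \<tau> \<alpha> h f) = tuple_act \<alpha> n (h, \<phi> h) (u f)"
  proof
    fix i
    show "u (map_conj G T \<tau> \<alpha> h f) i = tuple_act \<alpha> n (h, \<phi> h) (u f) i"
    proof (cases "i \<in> {1..n}")
      case True
      let ?j = "inv_into UNIV (\<phi> h) i"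
      have j: "?j \<in> {1..n}"
        using True permutes_in_image[OF permutes_inv[OF phi_permutes[OF h]]] by blast
      have "\<phi> h ?j = i" using permutes_inverses(1)[OF phi_permutes[OF h]] .
      then have "ord i = \<tau> h (ord ?j)" using ord_phi[OF h j] by simp
      then have "\<tau> (m_inv G h) (ord i) = ord ?j" using tau_inv[OF h ord_in[OF j]] by simp
      then show ?thesis
        using True j ord_in[OF True] by (simp add: u_def map_conj_def tuple_act_def)
    next
      case False
      then show ?thesis by (auto simp: u_def tuple_act_def)
    qed
  qed
  have "u f \<in> {1..n} \<rightarrow>\<^sub>E topspace X"
    using continuous_map_funspace[OF cont_u] f by auto
  moreover have "\<phi> h \<in> carrier (sym_group n)"
    using phi_permutes[OF h] by (simp add: sym_group_carrier)
  moreover have "\<forall>n. \<forall>g\<in>carrier G. \<forall>\<sigma>\<in>carrier (sym_group n).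
      \<forall>d\<in>topspace (disk_space G \<rho> n). \<forall>x\<in>{1..n} \<rightarrow>\<^sub>E topspace X.
        \<theta> n (tuple_act (disk_conj \<rho>) n (g, \<sigma>) d) (tuple_act \<alpha> n (g, \<sigma>) x) = \<alpha> g (\<theta> n d x)"
    using X unfolding disks_algebra_def by (elim conjE)
  ultimately have "\<theta> n (tuple_act (disk_conj \<rho>) n (h, \<phi> h) d) (tuple_act \<alpha> n (h, \<phi> h) (u f)) =
      \<alpha> h (\<theta> n d (u f))"
    using H_carrier[OF h] dD by simp
  moreover have "tuple_act (disk_conj \<rho>) n (h, \<phi> h) d = d"
    using h by (intro fixed) (auto simp: graph_subgroup_def)
  ultimately show "multiplication \<theta> T ord d (map_conj G T \<tau> \<alpha> h f) =
      \<alpha> h (multiplication \<theta> T ord d f)"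
    by (simp add: mult u_conj)
qed

end

theorem theorem2p12:
  fixes G :: "('g, 'm) monoid_scheme"
    and \<rho> :: "'g \<Rightarrow> 'v::real_inner \<Rightarrow> 'v"
    and X :: "'x topology"
    and \<alpha> :: "'g \<Rightarrow> 'x \<Rightarrow> 'x"
    and \<theta> :: "nat \<Rightarrow> (nat \<Rightarrow> real \<times> 'v) \<Rightarrow> (nat \<Rightarrow> 'x) \<Rightarrow> 'x"
    and H :: "'g set"
    and T :: "'t set"
    and \<tau> :: "'g \<Rightarrow> 't \<Rightarrow> 't"
    and ord :: "nat \<Rightarrow> 't"
  assumes "group G" and "finite (carrier G)"
    and "orthogonal_rep G \<rho>"
    and "disks_algebra G \<rho> X \<alpha> \<theta>"
    and "subgroup H G"
    and "finite T" and "group_action (G\<lparr>carrier := H\<rparr>) T \<tau>"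
    and "bij_betw ord {1..card T} T"
  shows "subgroup (graph_subgroup H T \<tau> ord) (G \<times>\<times> sym_group (card T)) \<and>
    weak_equivalence
      (disk_fixed_space G \<rho> (card T) (graph_subgroup H T \<tau> ord))
      (embedding_space G \<rho> H T \<tau>)
      (centers T ord) \<and>
    (\<forall>d \<in> topspace (disk_fixed_space G \<rho> (card T) (graph_subgroup H T \<tau> ord)).
      equivariant_map_to G H T \<tau> X \<alpha> (multiplication \<theta> T ord d))"
proof -
  interpret ordered_H_set G \<rho> H T \<tau> ord
    using assms by (intro ordered_H_set.intro)
  show ?thesis
    using subgroup_graph weak_equivalence_centers equivariant_multiplication[OF assms(4)] by blast
qed

end
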